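(* Let the problem data satisfy the function assumption and the graph assumption of the context. Let $\kappa\in(0,1)$, and for all $i\in[n]$ let $\{x_{i,t}\}$ be the sequences generated by Algorithm 1 (see context) with $$\alpha_t=\frac{1}{t^{\kappa}},\quad \beta_t=\frac{1}{t^{\kappa}},\quad \gamma_t=\frac{1}{t^{1-\kappa}},\qquad \forall t\in\mathbb{N}_+ .$$ Then for any $T\in\mathbb{N}_+$, $$\mathrm{NetReg}(\{x_{i,t}\},\check{x}^*_{[T]})=\mathcal{O}(T^{\max\{\kappa,1-\kappa\}}),\qquad \frac1n\sum_{i=1}^n\sum_{t=1}^T\|[g_t(x_{i,t})]_+\|=\mathcal{O}(T^{1-\kappa/2}),$$ where $\check{x}^*_{[T]}=(\check{x}^*_T,\dots,\check{x}^*_T)$ and $\check{x}^*_T\in\mathbb{X}$ is a minimizer of $\sum_{t=1}^Tf_t(x)$ over $x\in\mathbb{X}$ subject to $g_t(x)\le\mathbf{0}_m$ for all $t\in[T]$. Here $a=\mathcal{O}(b)$ means $a\le Cb$ for a constant $C>0$ depending only on $\kappa,n,m,F_1,F_2,R(\mathbb{X}),w,B$ (in particular not on $T$).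
   Context: Notation: $[n]=\{1,\dots,n\}$; $\|\cdot\|$ is the Euclidean norm for vectors and the induced 2-norm for matrices; $\mathbb{B}^p$ is the closed unit ball of $\mathbb{R}^p$; inequalities between vectors are componentwise; $\mathcal{P}_{\mathbb{K}}$ is Euclidean projection onto $\mathbb{K}$; $[\cdot]_+$ is the componentwise positive part. $\mathrm{col}(\cdot)$ stacks column vectors. Problem: $n$ agents, a set $\mathbb{X}\subseteq\mathbb{R}^p$, and arbitrary sequences of functions $f_{i,t}:\mathbb{X}\to\mathbb{R}$ (local losses) and $g_{i,t}:\mathbb{X}\to\mathbb{R}^{m_i}$ (local constraints), $i\in[n]$, $t\in\mathbb{N}_+$. Put $m=\sum_i m_i$, $f_t(x)=\frac1n\sum_{j=1}^nf_{j,t}(x)$, $g_t(x)=\mathrm{col}(g_{1,t}(x),\dots,g_{n,t}(x))\in\mathbb{R}^m$. For a sequence $y_{[T]}=(y_1,\dots,y_T)$, $$\mathrm{NetReg}(\{x_{i,t}\},y_{[T]})=\frac1n\sum_{i=1}^n\sum_{t=1}^Tf_t(x_{i,t})-\sum_{t=1}^Tf_t(y_t).$$ The set $\check{\mathcal{X}}_T=\{(x,\dots,x): x\in\mathbb{X},\ g_t(x)\le\mathbf{0}_m\ \forall t\in[T]\}$ is assumed non-empty for every $T\in\mathbb{N}_+$. Subgradients: $\partial f(x)$ denotes a (chosen) subgradient of a scalar function $f$ at $x$; for $g=(g_1,\dots,g_d)$, $\partial g(x)=[\partial g_1(x),\dots,\partial g_d(x)]\in\mathbb{R}^{p\times d}$.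 For scalar $f$, $\partial[f(x)]_+=\mathbf{0}_p$ if $f(x)<0$ and $\partial[f(x)]_+=\partial f(x)$ otherwise; for vector functions $\partial[g(x)]_+$ has columns $\partial[g_k(x)]_+$. Function assumption: (1) $\mathbb{X}$ is convex and closed with $r(\mathbb{X})\mathbb{B}^p\subseteq\mathbb{X}\subseteq R(\mathbb{X})\mathbb{B}^p$ for constants $0<r(\mathbb{X})\le R(\mathbb{X})$. (2) All $f_{i,t}$ and (componentwise) $g_{i,t}$ are convex, and there is a constant $F_1$ with $|f_{i,t}(x)-f_{i,t}(y)|\le F_1$, $\|g_{i,t}(x)\|\le F_1$ for all $i,t$ and $x,y\in\mathbb{X}$. (3) The subgradients $\partial f_{i,t}(x),\partial g_{i,t}(x)$ exist for all $x\in\mathbb{X}$, and there is a constant $F_2$ with $\|\partial f_{i,t}(x)\|\le F_2$, $\|\partial g_{i,t}(x)\|\le F_2$ for all $i,t$, $x\in\mathbb{X}$. Graph assumption: at each $t$ there is a directed graph $\mathcal{G}_t=([n],\mathcal{E}_t)$ and a matrix $W_t\in\mathbb{R}^{n\times n}$ with $[W_t]_{ij}>0$ if $(j,i)\in\mathcal{E}_t$ or $i=j$ and $[W_t]_{ij}=0$ otherwise, such that for every $t\in\mathbb{N}_+$: (a) for a constant $w\in(0,1)$, $[W_t]_{ij}\ge w$ whenever $[W_t]_{ij}>0$; (b) $W_t$ is doubly stochastic; (c) for a fixed integer $B>0$, $([n],\cup_{l=0}^{B-1}\mathcal{E}_{t+l})$ is strongly connected. Algorithm 1 (full-information feedback),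 with non-increasing positive sequences $\{\alpha_t\},\{\beta_t\},\{\gamma_t\}$: choose $x_{i,1}\in\mathbb{X}$ arbitrarily and $q_{i,1}=\mathbf{0}_{m_i}$; for $t=1,2,\dots$ and every $i\in[n]$, $$z_{i,t+1}=\sum_{j=1}^n[W_t]_{ij}x_{j,t},\quad \omega_{i,t+1}=\partial f_{i,t}(x_{i,t})+\partial[g_{i,t}(x_{i,t})]_+q_{i,t},\quad x_{i,t+1}=\mathcal{P}_{\mathbb{X}}(z_{i,t+1}-\alpha_{t+1}\omega_{i,t+1}),$$ $$q_{i,t+1}=\big[(1-\beta_{t+1}\gamma_{t+1})q_{i,t}+\gamma_{t+1}\big([g_{i,t}(x_{i,t})]_++(\partial[g_{i,t}(x_{i,t})]_+)^\top(x_{i,t+1}-x_{i,t})\big)\big]_+.$$ *)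

theory Defs
  imports "HOL-Analysis.Analysis"
begin

section \<open>Euclidean spaces with the dimension as a term\<close>

text \<open>
  The asymptotic constants must not depend on the dimension \<open>p\<close> of the decision space, so \<open>p\<close> has to
  be quantified inside the formula, which type-indexed vectors do not allow. We therefore realise
  every \<open>\<real>\<^sup>d\<close> inside one type, the space of finitely supported real sequences with the Euclidean
  inner product: \<open>\<real>\<^sup>d\<close> is the subspace \<open>Rn d\<close> of vectors whose coordinates outside \<open>{1..d}\<close> vanish.
  Inner product, norm, closedness, convexity and operator norm are the library notions for
  \<open>real_inner\<close>. (The library's type \<open>poly_mapping\<close> of finitely supported functions is already normed, by the
  1-norm, hence the new type.)
\<close>

typedef fsvec = "{v :: nat \<Rightarrow> real. finite {k. v k \<noteq> 0}}"
  morphisms coord Abs_fsvec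
  by (rule exI[of _ "\<lambda>_. 0"]) simp

setup_lifting type_definition_fsvec

lemma finite_coord [simp]: "finite {k. coord v k \<noteq> 0}"
  using coord by auto

lemma fsvec_eqI: "(\<And>k. coord u k = coord v k) \<Longrightarrow> u = v"
  by (simp add: coord_inject[symmetric] fun_eq_iff)

instantiation fsvec :: real_vector
begin

lift_definition zero_fsvec :: fsvec is "\<lambda>_. 0" by simp
lift_definition plus_fsvec :: "fsvec \<Rightarrow> fsvec \<Rightarrow> fsvec" is "\<lambda>u v k. u k + v k"
  subgoal for u v by (rule finite_subset[of _ "{k. u k \<noteq> 0} \<union> {k. v k \<noteq> 0}"]) auto
  done
lift_definition minus_fsvec :: "fsvec \<Rightarrow> fsvec \<Rightarrow> fsvec" is "\<lambda>u v k. u k - v k"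
  subgoal for u v by (rule finite_subset[of _ "{k. u k \<noteq> 0} \<union> {k. v k \<noteq> 0}"]) auto
  done
lift_definition uminus_fsvec :: "fsvec \<Rightarrow> fsvec" is "\<lambda>v k. - v k" by simp
lift_definition scaleR_fsvec :: "real \<Rightarrow> fsvec \<Rightarrow> fsvec" is "\<lambda>c v k. c * v k"
  by (erule rev_finite_subset) auto

instance
  by standard (transfer; simp add: algebra_simps fun_eq_iff)+

end

lemma coord_zero [simp]: "coord 0 k = 0"
  and coord_add [simp]: "coord (u + v) k = coord u k + coord v k"
  and coord_diff [simp]: "coord (u - v) k = coord u k - coord v k"
  and coord_minus [simp]: "coord (- u) k = - coord u k"
  and coord_scaleR [simp]: "coord (c *\<^sub>R u) k = c * coord u k"
  by (transfer; simp)+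

lemma coord_sum [simp]: "coord (sum f A) k = (\<Sum>a\<in>A. coord (f a) k)"
  by (induction A rule: infinite_finite_induct) auto

instantiation fsvec :: real_inner
begin

definition inner_fsvec :: "fsvec \<Rightarrow> fsvec \<Rightarrow> real"
  where "inner_fsvec u v = (\<Sum>k | coord u k \<noteq> 0 \<and> coord v k \<noteq> 0. coord u k * coord v k)"

definition norm_fsvec :: "fsvec \<Rightarrow> real"
  where "norm_fsvec u = sqrt (inner u u)"

definition dist_fsvec :: "fsvec \<Rightarrow> fsvec \<Rightarrow> real"
  where "dist_fsvec u v = norm (u - v)"

definition sgn_fsvec :: "fsvec \<Rightarrow> fsvec"
  where "sgn_fsvec u = u /\<^sub>R norm u"

definition uniformity_fsvec :: "(fsvec \<times> fsvec) filter"
  where "uniformity_fsvec = (INF e\<in>{0<..}. principal {(u, v). dist u v < e})"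

definition open_fsvec :: "fsvec set \<Rightarrow> bool"
  where "open_fsvec U \<longleftrightarrow> (\<forall>u\<in>U. \<forall>\<^sub>F (u', v) in uniformity. u' = u \<longrightarrow> v \<in> U)"

lemma inner_fsvec_superset:
  assumes "finite A" and "\<And>k. coord u k \<noteq> 0 \<Longrightarrow> coord v k \<noteq> 0 \<Longrightarrow> k \<in> A"
  shows "inner u v = (\<Sum>k\<in>A. coord u k * coord v k)"
  unfolding inner_fsvec_def using assms by (intro sum.mono_neutral_left) auto

instance
proof
  fix u v w :: fsvec and c :: real
  show "inner u v = inner v u"
    by (simp add: inner_fsvec_def mult.commute conj_commute)
  let ?A = "{k. coord u k \<noteq> 0} \<union> {k. coord v k \<noteq> 0} \<union> {k. coord w k \<noteq> 0}"
  show "inner (u + v) w = inner u w + inner v w"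
    by (simp add: inner_fsvec_superset[where A = ?A] distrib_right sum.distrib)
  show "inner (c *\<^sub>R u) v = c * inner u v"
    by (simp add: inner_fsvec_superset[where A = ?A] sum_distrib_left mult.assoc)
  show "0 \<le> inner u u"
    by (simp add: inner_fsvec_def sum_nonneg)
  show "inner u u = 0 \<longleftrightarrow> u = 0"
    by (auto simp: inner_fsvec_def sum_nonneg_eq_0_iff intro: fsvec_eqI)
qed (simp_all add: norm_fsvec_def dist_fsvec_def sgn_fsvec_def uniformity_fsvec_def open_fsvec_def)

end

definition Rn :: "nat \<Rightarrow> fsvec set"
  where "Rn d = {v. \<forall>k. k \<notin> {1..d} \<longrightarrow> coord v k = 0}"

lemma inner_Rn: "u \<in> Rn d \<Longrightarrow> inner u v = (\<Sum>k\<in>{1..d}. coord u k * coord v k)"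
  by (rule inner_fsvec_superset) (auto simp: Rn_def)

lemma norm_Rn: "v \<in> Rn d \<Longrightarrow> norm v = sqrt (\<Sum>k\<in>{1..d}. (coord v k)\<^sup>2)"
  by (simp add: norm_eq_sqrt_inner inner_Rn power2_eq_square)

lift_definition vec_of :: "nat \<Rightarrow> (nat \<Rightarrow> real) \<Rightarrow> fsvec"
  is "\<lambda>d h k. if k \<in> {1..d} then h k else 0"
  by (rule finite_subset[of _ "{1..d}" for d]) auto

lift_definition unit_vec :: "nat \<Rightarrow> fsvec" is "\<lambda>j k. if k = j then 1 else 0"
  by simp

lift_definition pos_part :: "fsvec \<Rightarrow> fsvec" is "\<lambda>v k. max (v k) 0"
  by (erule rev_finite_subset) auto

definition vec_le :: "nat \<Rightarrow> fsvec \<Rightarrow> fsvec \<Rightarrow> bool"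
  where "vec_le d u v \<longleftrightarrow> (\<forall>k\<in>{1..d}. coord u k \<le> coord v k)"

text \<open>\<open>col n ms v\<close> stacks \<open>v 1 \<in> \<real>\<^bsup>ms 1\<^esup>, \<dots>, v n \<in> \<real>\<^bsup>ms n\<^esup>\<close>; entry \<open>k\<close> of block \<open>i\<close> lands at
  position \<open>ms 1 + \<dots> + ms (i - 1) + k\<close>.\<close>

definition col :: "nat \<Rightarrow> (nat \<Rightarrow> nat) \<Rightarrow> (nat \<Rightarrow> fsvec) \<Rightarrow> fsvec"
  where "col n ms v = (\<Sum>i\<in>{1..n}. \<Sum>k\<in>{1..ms i}. coord (v i) k *\<^sub>R unit_vec ((\<Sum>j\<in>{1..<i}. ms j) + k))"

text \<open>A matrix with \<open>d\<close> columns is given by its columns \<open>A 1, \<dots>, A d\<close>. As a map on the whole type,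
  \<open>mat_vec d A\<close> ignores coordinates outside \<open>{1..d}\<close>, so its operator norm is the induced 2-norm of
  the matrix.\<close>

type_synonym colmat = "nat \<Rightarrow> fsvec"

definition mat_vec :: "nat \<Rightarrow> colmat \<Rightarrow> fsvec \<Rightarrow> fsvec"
  where "mat_vec d A u = (\<Sum>k\<in>{1..d}. coord u k *\<^sub>R A k)"

definition transpose_mat_vec :: "nat \<Rightarrow> colmat \<Rightarrow> fsvec \<Rightarrow> fsvec"
  where "transpose_mat_vec d A v = vec_of d (\<lambda>k. inner (A k) v)"

definition mat_norm :: "nat \<Rightarrow> colmat \<Rightarrow> real"
  where "mat_norm d A = onorm (mat_vec d A)"

lemma bounded_linear_mat_vec: "bounded_linear (mat_vec d A)"
proof -
  have "bounded_linear (\<lambda>u. coord u k)" for k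
  proof (rule bounded_linear_intro[where K = 1])
    fix u
    have "coord u k = inner u (unit_vec k)"
      by (subst inner_fsvec_superset[where A = "{k}"])
         (auto simp: unit_vec.rep_eq split: if_splits)
    moreover have "norm (unit_vec k) = 1"
      unfolding norm_eq_sqrt_inner
      by (subst inner_fsvec_superset[where A = "{k}"]) (auto simp: unit_vec.rep_eq split: if_splits)
    ultimately show "norm (coord u k) \<le> norm u * 1"
      using Cauchy_Schwarz_ineq2[of u "unit_vec k"] by simp
  qed auto
  then show ?thesis
    unfolding mat_vec_def
    by (intro bounded_linear_sum bounded_linear_scaleR_const) auto
qed

text \<open>The library's \<open>closest_point\<close> is restricted to \<open>heine_borel\<close> types.\<close>

definition proj :: "fsvec set \<Rightarrow> fsvec \<Rightarrow> fsvec"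
  where "proj K z = (SOME x. x \<in> K \<and> (\<forall>y\<in>K. dist z x \<le> dist z y))"

definition is_subgradient :: "nat \<Rightarrow> fsvec set \<Rightarrow> (fsvec \<Rightarrow> real) \<Rightarrow> fsvec \<Rightarrow> fsvec \<Rightarrow> bool"
  where "is_subgradient p K h x v \<longleftrightarrow> v \<in> Rn p \<and> (\<forall>y\<in>K. h y \<ge> h x + inner v (y - x))"

section \<open>Problem data\<close>

text \<open>
  Agents are \<open>1, \<dots>, n\<close>, time starts at \<open>1\<close>. Throughout, \<open>f i t\<close> and \<open>g i t\<close> are the loss and
  the constraint function of agent \<open>i\<close> at time \<open>t\<close>, with chosen subgradients \<open>df i t x\<close> and, for
  \<open>1 \<le> k \<le> ms i\<close>, \<open>dg i t x k\<close> (the \<open>k\<close>-th column of \<open>\<partial>g\<close>); their values outside the set \<open>X\<close> are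
  irrelevant.
\<close>

type_synonym loss = "nat \<Rightarrow> nat \<Rightarrow> fsvec \<Rightarrow> real"
type_synonym constr = "nat \<Rightarrow> nat \<Rightarrow> fsvec \<Rightarrow> fsvec"
type_synonym loss_subgrad = "nat \<Rightarrow> nat \<Rightarrow> fsvec \<Rightarrow> fsvec"
type_synonym constr_subgrad = "nat \<Rightarrow> nat \<Rightarrow> fsvec \<Rightarrow> colmat"

definition function_assumption ::
    "nat \<Rightarrow> nat \<Rightarrow> (nat \<Rightarrow> nat) \<Rightarrow> fsvec set \<Rightarrow> loss \<Rightarrow> constr \<Rightarrow> loss_subgrad \<Rightarrow> constr_subgrad
      \<Rightarrow> real \<Rightarrow> real \<Rightarrow> real \<Rightarrow> real \<Rightarrow> bool"
  where "function_assumption p n ms X f g df dg r R F1 F2 \<longleftrightarrow>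
    X \<subseteq> Rn p \<and> convex X \<and> closed X \<and>
    0 < r \<and> r \<le> R \<and> Rn p \<inter> cball 0 r \<subseteq> X \<and> X \<subseteq> Rn p \<inter> cball 0 R \<and>
    (\<forall>i\<in>{1..n}. \<forall>t\<ge>1.
      (\<forall>x\<in>X. g i t x \<in> Rn (ms i)) \<and>
      convex_on X (f i t) \<and>
      (\<forall>k\<in>{1..ms i}. convex_on X (\<lambda>x. coord (g i t x) k)) \<and>
      (\<forall>x\<in>X. \<forall>y\<in>X. \<bar>f i t x - f i t y\<bar> \<le> F1) \<and>
      (\<forall>x\<in>X. norm (g i t x) \<le> F1) \<and>
      (\<forall>x\<in>X. is_subgradient p X (f i t) x (df i t x)) \<and>
      (\<forall>x\<in>X. \<forall>k\<in>{1..ms i}. is_subgradient p X (\<lambda>y. coord (g i t y) k) x (dg i t x k)) \<and>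
      (\<forall>x\<in>X. norm (df i t x) \<le> F2) \<and>
      (\<forall>x\<in>X. mat_norm (ms i) (dg i t x) \<le> F2))"

definition strongly_connected_on :: "nat set \<Rightarrow> (nat \<times> nat) set \<Rightarrow> bool"
  where "strongly_connected_on V E \<longleftrightarrow> (\<forall>u\<in>V. \<forall>v\<in>V. (u, v) \<in> E\<^sup>*)"

definition graph_assumption ::
    "nat \<Rightarrow> (nat \<Rightarrow> (nat \<times> nat) set) \<Rightarrow> (nat \<Rightarrow> nat \<Rightarrow> nat \<Rightarrow> real) \<Rightarrow> real \<Rightarrow> nat \<Rightarrow> bool"
  where "graph_assumption n E W w B \<longleftrightarrow>
    (\<forall>t\<ge>1.
      E t \<subseteq> {1..n} \<times> {1..n} \<and>
      (\<forall>i\<in>{1..n}. \<forall>j\<in>{1..n}.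
        (if (j, i) \<in> E t \<or> i = j then W t i j > 0 else W t i j = 0) \<and>
        (W t i j > 0 \<longrightarrow> W t i j \<ge> w)) \<and>
      (\<forall>i\<in>{1..n}. (\<Sum>j\<in>{1..n}. W t i j) = 1) \<and>
      (\<forall>j\<in>{1..n}. (\<Sum>i\<in>{1..n}. W t i j) = 1) \<and>
      strongly_connected_on {1..n} (\<Union>l\<in>{0..B - 1}. E (t + l)))"

definition global_loss :: "nat \<Rightarrow> loss \<Rightarrow> nat \<Rightarrow> fsvec \<Rightarrow> real"
  where "global_loss n f t x = (1 / real n) * (\<Sum>j\<in>{1..n}. f j t x)"

definition global_constr :: "nat \<Rightarrow> (nat \<Rightarrow> nat) \<Rightarrow> constr \<Rightarrow> nat \<Rightarrow> fsvec \<Rightarrow> fsvec"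
  where "global_constr n ms g t x = col n ms (\<lambda>i. g i t x)"

text \<open>The points \<open>x\<close> whose constant sequence \<open>(x, \<dots>, x)\<close> satisfies all constraints up to time \<open>T\<close>.\<close>

definition static_feasible ::
    "nat \<Rightarrow> (nat \<Rightarrow> nat) \<Rightarrow> fsvec set \<Rightarrow> constr \<Rightarrow> nat \<Rightarrow> fsvec set"
  where "static_feasible n ms X g T =
    {x \<in> X. \<forall>t\<in>{1..T}. vec_le (\<Sum>i\<in>{1..n}. ms i) (global_constr n ms g t x) 0}"

definition net_reg :: "nat \<Rightarrow> loss \<Rightarrow> (nat \<Rightarrow> nat \<Rightarrow> fsvec) \<Rightarrow> (nat \<Rightarrow> fsvec) \<Rightarrow> nat \<Rightarrow> real"
  where "net_reg n f x y T =
    (1 / real n) * (\<Sum>i\<in>{1..n}. \<Sum>t\<in>{1..T}. global_loss n f t (x i t))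
      - (\<Sum>t\<in>{1..T}. global_loss n f t (y t))"

section \<open>The algorithm\<close>

definition dg_pos :: "constr \<Rightarrow> constr_subgrad \<Rightarrow> constr_subgrad"
  where "dg_pos g dg i t x k = (if coord (g i t x) k < 0 then 0 else dg i t x k)"

definition generated_by_algorithm ::
    "nat \<Rightarrow> (nat \<Rightarrow> nat) \<Rightarrow> fsvec set \<Rightarrow> constr \<Rightarrow> loss_subgrad \<Rightarrow> constr_subgrad
      \<Rightarrow> (nat \<Rightarrow> nat \<Rightarrow> nat \<Rightarrow> real) \<Rightarrow> (nat \<Rightarrow> real) \<Rightarrow> (nat \<Rightarrow> real) \<Rightarrow> (nat \<Rightarrow> real)
      \<Rightarrow> (nat \<Rightarrow> nat \<Rightarrow> fsvec) \<Rightarrow> (nat \<Rightarrow> nat \<Rightarrow> fsvec) \<Rightarrow> bool"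
  where "generated_by_algorithm n ms X g df dg W \<alpha> \<beta> \<gamma> x q \<longleftrightarrow>
    (\<forall>i\<in>{1..n}. x i 1 \<in> X \<and> q i 1 = 0) \<and>
    (\<forall>t\<ge>1. \<forall>i\<in>{1..n}.
      let z = (\<Sum>j\<in>{1..n}. W t i j *\<^sub>R x j t);
          D = dg_pos g dg i t (x i t);
          \<omega> = df i t (x i t) + mat_vec (ms i) D (q i t)
      in x i (t + 1) = proj X (z - \<alpha> (t + 1) *\<^sub>R \<omega>) \<and>
         q i (t + 1) = pos_part ((1 - \<beta> (t + 1) * \<gamma> (t + 1)) *\<^sub>R q i t
           + \<gamma> (t + 1) *\<^sub>R (pos_part (g i t (x i t))
               + transpose_mat_vec (ms i) D (x i (t + 1) - x i t))))"

end

(*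
  The projection inequality and the drift of the dual variables give, per agent, a bound on the
  instantaneous regret plus the increments of the squared dual norm and of the squared distance to
  a feasible point y, plus the squared projection residual over 2 alpha. The terms in which the
  duals multiply the constraint subgradients cancel exactly. Double stochasticity makes the
  distances telescope over the network, and 1/gamma(t+1) - 1/gamma(t) <= beta(t+1) lets the damping
  absorb the varying dual step size.

  Over n B steps the products of the mixing matrices have all entries at least w^(n B). The spread
  of the iterates therefore contracts up to the residuals, so that its sum is at most a constant
  plus a multiple of the sum of the residuals, which AM-GM absorbs into the residual energy. This
  is the regret bound, and together with the bounded oscillation of the losses it also bounds
  the energies by O(T).

  The violation is read off the dual update: it is at most
  (q(t+1) - q(t)) / gamma + beta q(t) plus the movement of the iterate. AM-GM with parameter
  T^(kappa/2) reduces the sum of these terms to the energies.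
*)
theory Submission
  imports Defs
begin

section \<open>Finitely supported vectors\<close>

text \<open>No Slater-type condition is available, so the dual variables need not stay bounded:
  damping only gives \<beta> |q| \<le> F1, which allows growth like t^\<kappa>. Two choices follow.
  The drift is expanded around \<open>dual_input\<close> minus \<beta> q, which is bounded although
  q may not be. And the movement of an iterate is never estimated by the step length \<alpha>
  |\<omega>|, which would be O(1) per step since \<omega> contains q; it is estimated by the
  residual, whose square enters the projection inequality with a favourable sign and weight
  1/\<alpha>.

  The spread is charged twice with factor n F2: once for the movement of the iterates, once because
  losses and constraints of one agent are evaluated at the points of the others. Hence the same
  constant \<open>residual_price\<close> serves regret and violation.

  Violations are summed in the l1 norm, in which the dual recursion can be added coordinatewise;
  this costs sqrt m. The rate 1 - \<kappa>/2 balances energies of order T divided by h against h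
  T^(1-\<kappa>).\<close>

lemma coord_vec_of [simp]: "coord (vec_of d h) k = (if k \<in> {1..d} then h k else 0)"
  by transfer simp

lemma coord_unit_vec [simp]: "coord (unit_vec j) k = (if k = j then 1 else 0)"
  by transfer simp

lemma coord_pos_part [simp]: "coord (pos_part v) k = max (coord v k) 0"
  by transfer simp

lemma norm_unit_vec [simp]: "norm (unit_vec k) = 1"
  unfolding norm_eq_sqrt_inner
  by (subst inner_fsvec_superset[where A = "{k}"]) (auto split: if_splits)

lemma inner_fsvec_mono:
  assumes "\<And>k. 0 \<le> coord u k" and "\<And>k. coord v k \<le> coord w k"
  shows "inner u v \<le> inner u w"
proof -
  let ?A = "{k. coord u k \<noteq> 0}"
  have "inner u v = (\<Sum>k\<in>?A. coord u k * coord v k)"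
    by (rule inner_fsvec_superset) auto
  also have "\<dots> \<le> (\<Sum>k\<in>?A. coord u k * coord w k)"
    by (intro sum_mono mult_left_mono assms)
  also have "\<dots> = inner u w"
    by (rule inner_fsvec_superset[symmetric]) auto
  finally show ?thesis .
qed

lemma norm_fsvec_mono:
  assumes "\<And>k. \<bar>coord u k\<bar> \<le> \<bar>coord v k\<bar>"
  shows "norm u \<le> norm v"
proof -
  let ?A = "{k. coord u k \<noteq> 0} \<union> {k. coord v k \<noteq> 0}"
  have "inner u u = (\<Sum>k\<in>?A. coord u k * coord u k)"
    by (rule inner_fsvec_superset) auto
  also have "\<dots> \<le> (\<Sum>k\<in>?A. coord v k * coord v k)"
    by (intro sum_mono) (use assms in \<open>simp add: abs_le_square_iff flip: power2_eq_square\<close>)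
  also have "\<dots> = inner v v"
    by (rule inner_fsvec_superset[symmetric]) auto
  finally show ?thesis
    by (simp add: norm_eq_sqrt_inner)
qed

lemma norm_pos_part_le: "norm (pos_part v) \<le> norm v"
  by (rule norm_fsvec_mono) auto

text \<open>Cauchy-Schwarz against the indicator of \<open>A\<close>. All passages from the 2-norm
  to l1 sums rest on it, and it is the origin of the factor sqrt m in the violation
  constant.\<close>

lemma sum_abs_coord_le:
  assumes "finite A"
  shows "(\<Sum>k\<in>A. \<bar>coord v k\<bar>) \<le> sqrt (card A) * norm v"
proof -
  let ?A = "A \<union> {k. coord v k \<noteq> 0}"
  have "(\<Sum>k\<in>A. \<bar>coord v k\<bar>)\<^sup>2 \<le> (\<Sum>k\<in>A. \<bar>coord v k\<bar>\<^sup>2) * card A"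
    by (rule sum_squared_le_sum_of_squares)
  also have "(\<Sum>k\<in>A. \<bar>coord v k\<bar>\<^sup>2) \<le> (\<Sum>k\<in>?A. \<bar>coord v k\<bar>\<^sup>2)"
    using assms by (intro sum_mono2) auto
  also have "\<dots> = inner v v"
    by (subst inner_fsvec_superset[where A = ?A]) (use assms in \<open>auto simp: power2_eq_square\<close>)
  also have "\<dots> = (norm v)\<^sup>2"
    by (simp add: dot_square_norm)
  finally have "(\<Sum>k\<in>A. \<bar>coord v k\<bar>) \<le> sqrt ((norm v)\<^sup>2 * card A)"
    by (intro real_le_rsqrt) (simp add: mult_right_mono)
  then show ?thesis
    by (simp add: real_sqrt_mult mult.commute)
qed

section \<open>Positive parts and stacked vectors\<close>

lemma pos_part_zero [simp]: "pos_part 0 = 0"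
  by (rule fsvec_eqI) simp

lemma norm_pos_part_add_le: "norm (pos_part (u + v)) \<le> norm (pos_part u) + norm (pos_part v)"
proof -
  have "norm (pos_part (u + v)) \<le> norm (pos_part u + pos_part v)"
    by (rule norm_fsvec_mono) (auto simp: max_def)
  then show ?thesis
    using norm_triangle_ineq order_trans by blast
qed

lemma norm_pos_part_sum_le: "norm (pos_part (sum f A)) \<le> (\<Sum>a\<in>A. norm (pos_part (f a)))"
proof (induction A rule: infinite_finite_induct)
  case (insert a A)
  then show ?case
    using norm_pos_part_add_le[of "f a" "sum f A"] by simp
qed auto

lemma norm_pos_part_unit_vec: "norm (pos_part (c *\<^sub>R unit_vec k)) = max c 0"
proof -
  have "pos_part (c *\<^sub>R unit_vec k) = max c 0 *\<^sub>R unit_vec k"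
    by (rule fsvec_eqI) simp
  then show ?thesis by simp
qed

text \<open>Triangle inequality over the summands of \<open>col\<close>. It replaces the 2-norm of
  the stacked violation by an l1 sum, which splits over agents.\<close>

lemma norm_pos_part_col_le:
  "norm (pos_part (col n ms v)) \<le> (\<Sum>i\<in>{1..n}. \<Sum>k\<in>{1..ms i}. max (coord (v i) k) 0)"
  unfolding col_def
  by (intro norm_pos_part_sum_le[THEN order_trans] sum_mono) (simp add: norm_pos_part_unit_vec)

text \<open>The blocks occupy disjoint intervals of positions, so exactly one summand of
  \<open>col\<close> reaches a given position.\<close>

lemma coord_col:
  assumes i: "i \<in> {1..n}" and k: "k \<in> {1..ms i}"
  shows "coord (col n ms v) ((\<Sum>j\<in>{1..<i}. ms j) + k) = coord (v i) k"
proof -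
  let ?o = "\<lambda>i. \<Sum>j\<in>{1..<i}. ms j"
  have off: "?o a + ms a \<le> ?o b" if "1 \<le> a" "a < b" for a b
  proof -
    have "?o a + ms a = (\<Sum>j\<in>{1..<Suc a}. ms j)"
      using that by simp
    also have "\<dots> \<le> ?o b"
      using that by (intro sum_mono2) auto
    finally show ?thesis .
  qed
  \<comment> \<open>If the block numbers differ, \<open>off\<close> places the whole earlier block,
    its last position included, strictly below the first entry of the later one.\<close>
  have inj: "?o i + k = ?o a + l \<longleftrightarrow> a = i \<and> l = k" if "a \<in> {1..n}" "l \<in> {1..ms a}" for a l
  proof (cases a i rule: linorder_cases)
    case less
    then show ?thesis using off[of a i] that i k by auto
  next
    case greater
    then show ?thesis using off[of i a] that i k by auto
  qed auto
  have "coord (col n ms v) (?o i + k)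
      = (\<Sum>a\<in>{1..n}. \<Sum>l\<in>{1..ms a}. coord (v a) l * (if ?o i + k = ?o a + l then 1 else 0))"
    by (simp add: col_def)
  also have "\<dots> = (\<Sum>a\<in>{1..n}. \<Sum>l\<in>{1..ms a}. if a = i \<and> l = k then coord (v i) k else 0)"
    by (intro sum.cong refl) (use inj in auto)
  also have "\<dots> = (\<Sum>a\<in>{1..n}. if a = i then coord (v i) k else 0)"
    using k by (intro sum.cong refl) auto
  also have "\<dots> = coord (v i) k"
    using i by simp
  finally show ?thesis .
qed

text \<open>Feasibility is stated for the stacked vector, whereas the per-agent inequalities need it
  block by block.\<close>

lemma col_le_zeroD:
  assumes "vec_le (\<Sum>i\<in>{1..n}. ms i) (col n ms v) 0" and i: "i \<in> {1..n}" and k: "k \<in> {1..ms i}"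
  shows "coord (v i) k \<le> 0"
proof -
  have "(\<Sum>j\<in>{1..<i}. ms j) + k \<le> (\<Sum>j\<in>{1..<Suc i}. ms j)"
    using i k by simp
  also have "\<dots> \<le> (\<Sum>i\<in>{1..n}. ms i)"
    using i by (intro sum_mono2) auto
  finally show ?thesis
    using assms(1) coord_col[where v = v and ms = ms, OF i k] k
    by (auto simp: vec_le_def dest!: bspec[where x = "(\<Sum>j\<in>{1..<i}. ms j) + k"])
qed

text \<open>Adjointness. It shows that the dual part of the primal direction and the linear part of
  the dual input are the same bilinear form, which is why they can cancel.\<close>

lemma inner_mat_vec: "inner (mat_vec d A u) v = inner u (transpose_mat_vec d A v)"
proof -
  have "inner (mat_vec d A u) v = (\<Sum>k\<in>{1..d}. coord u k * inner (A k) v)"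
    by (simp add: mat_vec_def inner_sum_left)
  also have "\<dots> = inner u (transpose_mat_vec d A v)"
    unfolding transpose_mat_vec_def
    by (subst inner_fsvec_superset[where A = "{1..d}"]) (auto split: if_splits)
  finally show ?thesis .
qed

text \<open>A transpose has no larger operator norm: test the matrix on the vector
  \<open>transpose_mat_vec d A v\<close> itself and divide by its norm.\<close>

lemma norm_transpose_mat_vec_le: "norm (transpose_mat_vec d A v) \<le> mat_norm d A * norm v"
proof -
  let ?u = "transpose_mat_vec d A v"
  have "norm ?u * norm ?u = inner (mat_vec d A ?u) v"
    by (simp add: inner_mat_vec dot_square_norm flip: power2_eq_square)
  also have "\<dots> \<le> norm (mat_vec d A ?u) * norm v"
    by (rule norm_cauchy_schwarz)
  also have "\<dots> \<le> (mat_norm d A * norm ?u) * norm v"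
    unfolding mat_norm_def
    by (intro mult_right_mono onorm[OF bounded_linear_mat_vec]) auto
  finally show ?thesis
    by (cases "norm ?u = 0")
       (auto simp: mat_norm_def onorm_pos_le[OF bounded_linear_mat_vec] mult.assoc mult.left_commute)
qed

section \<open>Compactness and projection\<close>

text \<open>The whole type is infinite-dimensional, so bounded closed sets need not be compact in
  it. Inside \<open>Rn d\<close> this follows by induction: adding a coordinate is a continuous map
  from an interval times the smaller box.\<close>

lemma compact_box:
  "compact {v \<in> Rn d. \<forall>k. \<bar>coord v k\<bar> \<le> c}"
proof (induction d)
  case 0
  have "Rn 0 \<subseteq> {0}"
    by (auto simp: Rn_def fsvec_eqI)
  then have "{v \<in> Rn 0. \<forall>k. \<bar>coord v k\<bar> \<le> c} \<subseteq> {0}"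
    by blast
  then have "finite {v \<in> Rn 0. \<forall>k. \<bar>coord v k\<bar> \<le> c}"
    using finite_subset by blast
  then show ?case
    by (rule finite_imp_compact)
next
  case (Suc d)
  let ?K = "\<lambda>d. {v \<in> Rn d. \<forall>k. \<bar>coord v k\<bar> \<le> c}"
  let ?h = "\<lambda>(a, v). v + a *\<^sub>R unit_vec (Suc d)"
  have eq: "?K (Suc d) = ?h ` ({-c..c} \<times> ?K d)"
  proof (intro equalityI subsetI)
    fix v assume v: "v \<in> ?K (Suc d)"
    then have v: "\<And>k. k \<notin> {1..Suc d} \<Longrightarrow> coord v k = 0" "\<And>k. \<bar>coord v k\<bar> \<le> c"
      by (auto simp: Rn_def)
    have "v = ?h (coord v (Suc d), vec_of d (coord v))"
      by (rule fsvec_eqI) (auto simp: v(1))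
    moreover have "coord v (Suc d) \<in> {-c..c}"
      using v(2)[of "Suc d"] by (simp add: abs_le_iff)
    \<comment> \<open>Truncation by \<open>vec_of\<close> creates zero coordinates, which lie in the
      box only for nonnegative \<open>c\<close>.\<close>
    moreover have "0 \<le> c"
      using v(2)[of 0] by linarith
    then have "vec_of d (coord v) \<in> ?K d"
      using v(2) by (simp add: Rn_def)
    ultimately show "v \<in> ?h ` ({-c..c} \<times> ?K d)"
      by blast
  next
    fix v assume "v \<in> ?h ` ({-c..c} \<times> ?K d)"
    then obtain w where w: "w \<in> {-c..c} \<times> ?K d" and vw: "v = ?h w"
      by (rule imageE)
    define a u where "a = fst w" and "u = snd w"
    have v: "v = u + a *\<^sub>R unit_vec (Suc d)"
      using vw by (simp add: a_def u_def case_prod_unfold)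
    have a: "a \<in> {-c..c}" and u: "u \<in> ?K d"
      using w unfolding a_def u_def by (simp_all only: mem_Times_iff)
    have "coord u (Suc d) = 0" and "\<bar>a\<bar> \<le> c"
      using u a by (simp_all add: Rn_def abs_le_iff)
    then have "\<bar>coord v k\<bar> \<le> c" for k
      using u by (cases "k = Suc d") (simp_all add: v)
    moreover have "v \<in> Rn (Suc d)"
      unfolding Rn_def mem_Collect_eq
    proof (intro allI impI)
      fix k assume "k \<notin> {1..Suc d}"
      then have "k \<notin> {1..d}" and "k \<noteq> Suc d" by auto
      with u show "coord v k = 0" by (simp add: Rn_def v)
    qed
    ultimately show "v \<in> ?K (Suc d)"
      by blast
  qed
  have "continuous_on ({-c..c} \<times> ?K d) ?h"
    unfolding case_prod_unfold by (intro continuous_intros)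
  then show ?case
    unfolding eq by (rule compact_continuous_image) (rule compact_Times[OF compact_Icc Suc])
qed

lemma abs_coord_le_norm: "\<bar>coord v k\<bar> \<le> norm v"
  using sum_abs_coord_le[of "{k}" v] by simp

lemma compact_subset_Rn:
  assumes "closed X" and "X \<subseteq> Rn d \<inter> cball 0 c"
  shows "compact X"
proof -
  have "X \<subseteq> {v \<in> Rn d. \<forall>k. \<bar>coord v k\<bar> \<le> c}"
  proof
    fix v assume "v \<in> X"
    then have "v \<in> Rn d" and "norm v \<le> c"
      using assms(2) by auto
    then show "v \<in> {v \<in> Rn d. \<forall>k. \<bar>coord v k\<bar> \<le> c}"
      using abs_coord_le_norm[of v] order_trans by auto
  qed
  then show ?thesis
    using compact_Int_closed[OF compact_box[of d c] \<open>closed X\<close>] by (simp add: Int_absorb1)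
qed

text \<open>Compactness provides a nearest point, so the choice operator in \<open>proj\<close> has
  a witness.\<close>

lemma proj_closest:
  assumes "compact K" and "K \<noteq> {}"
  shows "proj K z \<in> K" and "\<And>y. y \<in> K \<Longrightarrow> dist z (proj K z) \<le> dist z y"
proof -
  have "continuous_on K (dist z)"
    by (intro continuous_intros)
  then have "\<exists>x. x \<in> K \<and> (\<forall>y\<in>K. dist z x \<le> dist z y)"
    using continuous_attains_inf[OF assms] by blast
  then have "proj K z \<in> K \<and> (\<forall>y\<in>K. dist z (proj K z) \<le> dist z y)"
    unfolding proj_def by (rule someI_ex)
  then show "proj K z \<in> K" and "\<And>y. y \<in> K \<Longrightarrow> dist z (proj K z) \<le> dist z y"
    by auto
qed

text \<open>The variational inequality of the projection. Moving from the projection towards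
  \<open>y\<close> by a fraction s stays in \<open>K\<close> and cannot decrease the distance to
  \<open>z\<close>; expand the squares, divide by s and let s tend to 0.\<close>

lemma inner_proj_le_zero:
  assumes "compact K" and "convex K" and "y \<in> K"
  shows "inner (z - proj K z) (y - proj K z) \<le> 0"
proof -
  let ?x = "proj K z"
  have K: "K \<noteq> {}" using \<open>y \<in> K\<close> by blast
  have "2 * inner (z - ?x) (y - ?x) \<le> s * (norm (y - ?x))\<^sup>2" if s: "0 < s" "s \<le> 1" for s
  proof -
    have "?x + s *\<^sub>R (y - ?x) = (1 - s) *\<^sub>R ?x + s *\<^sub>R y"
      by (simp add: algebra_simps)
    also have "\<dots> \<in> K"
      using s proj_closest(1)[OF \<open>compact K\<close> K] \<open>y \<in> K\<close> \<open>convex K\<close> by (intro convexD) auto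
    finally have "norm (z - ?x) \<le> norm (z - ?x - s *\<^sub>R (y - ?x))"
      using proj_closest(2)[OF \<open>compact K\<close> K, of "?x + s *\<^sub>R (y - ?x)" z]
      by (simp add: dist_norm diff_diff_add)
    then have "(norm (z - ?x))\<^sup>2 \<le> (norm (z - ?x - s *\<^sub>R (y - ?x)))\<^sup>2"
      by (simp add: power_mono)
    also have "\<dots> = (norm (z - ?x))\<^sup>2 - 2 * s * inner (z - ?x) (y - ?x) + s\<^sup>2 * (norm (y - ?x))\<^sup>2"
      using dot_norm_neg[of "z - ?x" "s *\<^sub>R (y - ?x)"] by (simp add: power_mult_distrib)
    finally have "s * (2 * inner (z - ?x) (y - ?x)) \<le> s * (s * (norm (y - ?x))\<^sup>2)"
      by (simp add: power2_eq_square algebra_simps)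
    then show ?thesis
      using s by simp
  qed
  then have "\<forall>\<^sub>F s in at_right 0. 2 * inner (z - ?x) (y - ?x) \<le> s * (norm (y - ?x))\<^sup>2"
    by (intro eventually_at_rightI[of 0 1]) auto
  moreover have "((\<lambda>s. s * (norm (y - ?x))\<^sup>2) \<longlongrightarrow> 0 * (norm (y - ?x))\<^sup>2) (at_right 0)"
    by (intro tendsto_intros)
  ultimately have "2 * inner (z - ?x) (y - ?x) \<le> 0 * (norm (y - ?x))\<^sup>2"
    by (intro tendsto_lowerbound) auto
  then show ?thesis by simp
qed

lemma norm_convex_combination_square_le:
  fixes x :: "'a \<Rightarrow> 'b::real_inner"
  assumes "finite A" and "\<And>j. j \<in> A \<Longrightarrow> 0 \<le> c j" and "sum c A = 1"
  shows "(norm ((\<Sum>j\<in>A. c j *\<^sub>R x j) - y))\<^sup>2 \<le> (\<Sum>j\<in>A. c j * (norm (x j - y))\<^sup>2)"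
proof -
  have "A \<noteq> {}" using assms by auto
  have "(\<Sum>j\<in>A. c j *\<^sub>R x j) - y = (\<Sum>j\<in>A. c j *\<^sub>R (x j - y))"
    using assms(3) by (simp add: scaleR_diff_right sum_subtractf flip: scaleR_sum_left)
  then have "norm ((\<Sum>j\<in>A. c j *\<^sub>R x j) - y) \<le> (\<Sum>j\<in>A. c j * norm (x j - y))"
    using assms(2) by (auto intro!: order_trans[OF norm_sum] sum_mono)
  then have "(norm ((\<Sum>j\<in>A. c j *\<^sub>R x j) - y))\<^sup>2 \<le> (\<Sum>j\<in>A. c j * norm (x j - y))\<^sup>2"
    by (intro power_mono) auto
  also have "\<dots> \<le> (\<Sum>j\<in>A. c j * (norm (x j - y))\<^sup>2)"
    using convex_on_sum[OF \<open>finite A\<close> \<open>A \<noteq> {}\<close> convex_power2 assms(3,2), of "\<lambda>j. norm (x j - y)"]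
    by simp
  finally show ?thesis .
qed

section \<open>Sums of powers and summation by parts\<close>

text \<open>The usual integral comparison, done by induction. The discrete increment is the weighted
  AM-GM inequality for T + 1 and T + 2.\<close>

lemma sum_inverse_powr_le:
  assumes "0 < a" and "a < 1"
  shows "(\<Sum>t\<in>{1..T}. 1 / real (t + 1) powr a) \<le> real (T + 1) powr (1 - a) / (1 - a)"
proof (induction T)
  case (Suc T)
  have step: "real (T + 1) powr (1 - a) + (1 - a) / real (T + 2) powr a \<le> real (T + 2) powr (1 - a)"
  proof -
    \<comment> \<open>The right-hand side equals (T + 2) - (1 - a), so division by (T + 2)^a gives
      the claimed increment.\<close>
    have "real (T + 1) powr (1 - a) * real (T + 2) powr a \<le> (1 - a) * real (T + 1) + a * real (T + 2)"
      using assms by (intro Youngs_inequality_0) auto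
    also have "\<dots> = real (T + 2) powr (1 - a) * real (T + 2) powr a - (1 - a)"
    proof -
      have "real (T + 2) powr (1 - a) * real (T + 2) powr a = real (T + 2)"
        by (simp flip: powr_add)
      then show ?thesis by (simp add: algebra_simps)
    qed
    finally have "(real (T + 1) powr (1 - a) + (1 - a) / real (T + 2) powr a) * real (T + 2) powr a
        \<le> real (T + 2) powr (1 - a) * real (T + 2) powr a"
      by (simp add: distrib_right)
    then show ?thesis
      by (rule mult_right_le_imp_le) simp
  qed
  have "(\<Sum>t\<in>{1..Suc T}. 1 / real (t + 1) powr a)
      \<le> real (T + 1) powr (1 - a) / (1 - a) + 1 / real (T + 2) powr a"
    using Suc by simp
  also have "\<dots> = (real (T + 1) powr (1 - a) + (1 - a) / real (T + 2) powr a) / (1 - a)"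
    using assms by (simp add: add_divide_distrib)
  also have "\<dots> \<le> real (T + 2) powr (1 - a) / (1 - a)"
    using assms step by (intro divide_right_mono) auto
  finally show ?case by (simp add: add.commute)
qed (use assms in auto)

lemma Suc_powr_le_two_mult:
  assumes "1 \<le> T" and "0 \<le> a" and "a \<le> 1"
  shows "real (T + 1) powr a \<le> 2 * real T powr a"
proof -
  have "real (T + 1) powr a \<le> (2 * real T) powr a"
    using assms by (intro powr_mono2) auto
  also have "\<dots> = 2 powr a * real T powr a"
    by (simp add: powr_mult)
  also have "\<dots> \<le> 2 powr 1 * real T powr a"
    using assms by (intro mult_right_mono powr_mono) auto
  finally show ?thesis by simp
qed

lemma mult_le_weighted_square:
  fixes c h u :: real
  assumes "0 \<le> c" and "0 < h"
  shows "c * u \<le> c * h / 2 + c * u\<^sup>2 / (2 * h)"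
proof -
  have "0 \<le> c * (u - h)\<^sup>2 / (2 * h)"
    using assms by simp
  also have "\<dots> = c * h / 2 + c * u\<^sup>2 / (2 * h) - c * u"
    using assms by (simp add: field_simps power2_eq_square)
  finally show ?thesis by simp
qed

text \<open>Summation by parts: every increase of the weight multiplies some value of
  \<open>V\<close>, which is replaced by its bound \<open>c\<close>, and the weight increases then
  telescope.\<close>

lemma sum_weighted_decrease_le:
  fixes V a :: "nat \<Rightarrow> real"
  assumes "\<And>t. 1 \<le> t \<Longrightarrow> t \<le> T + 1 \<Longrightarrow> 0 \<le> V t \<and> V t \<le> c"
    and "\<And>t. 1 \<le> t \<Longrightarrow> 0 \<le> a t \<and> a t \<le> a (t + 1)"
  shows "(\<Sum>t\<in>{1..T}. a (t + 1) * (V t - V (t + 1))) \<le> a (T + 1) * c"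
proof -
  \<comment> \<open>The boundary term must be carried along: the next weight increase acts on
    \<open>V (T + 1)\<close>.\<close>
  have "(\<Sum>t\<in>{1..T}. a (t + 1) * (V t - V (t + 1))) + a (T + 1) * V (T + 1) \<le> a (T + 1) * c"
    using assms(1)
  proof (induction T)
    case 0
    then show ?case using assms(2)[of 1] by (simp add: mult_left_mono)
  next
    case (Suc T)
    have "(a (T + 2) - a (T + 1)) * V (T + 1) \<le> (a (T + 2) - a (T + 1)) * c"
      using Suc.prems[of "T + 1"] assms(2)[of "T + 1"] by (intro mult_left_mono) auto
    moreover have "(\<Sum>t\<in>{1..T}. a (t + 1) * (V t - V (t + 1))) + a (T + 1) * V (T + 1) \<le> a (T + 1) * c"
      by (rule Suc.IH) (use Suc.prems in auto)
    ultimately show ?case by (simp add: algebra_simps)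
  qed
  moreover have "0 \<le> a (T + 1) * V (T + 1)"
    using assms(1)[of "T + 1"] assms(2)[of "T + 1"] by simp
  ultimately show ?thesis by simp
qed

text \<open>Summation by parts for sequences that start at zero, as the duals do, so only the final
  boundary term remains.\<close>

lemma sum_weighted_increase:
  fixes Q a :: "nat \<Rightarrow> real"
  assumes "Q 1 = 0"
  shows "(\<Sum>t\<in>{1..T}. a (t + 1) * (Q (t + 1) - Q t))
    = a (T + 1) * Q (T + 1) - (\<Sum>t\<in>{1..T}. (a (t + 1) - a t) * Q t)"
proof (induction T)
  case (Suc T)
  then show ?case by (simp add: algebra_simps)
qed (use assms in simp)

section \<open>Consensus over jointly connected graphs\<close>

text \<open>The matrix product W(s+k-1) ... W(s), with the latest factor on the left: entry (i, j)
  is the weight of agent j's value at time s in agent i's value at time s + k.\<close>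

primrec transition ::
  "nat \<Rightarrow> (nat \<Rightarrow> nat \<Rightarrow> nat \<Rightarrow> real) \<Rightarrow> nat \<Rightarrow> nat \<Rightarrow> nat \<Rightarrow> nat \<Rightarrow> real"
where
  "transition n W s 0 = (\<lambda>i j. if i = j then 1 else 0)"
| "transition n W s (Suc k) = (\<lambda>i j. \<Sum>l\<in>{1..n}. W (s + k) i l * transition n W s k l j)"

text \<open>A Dobrushin-type contraction. The common part \<eta> of all weights cancels in the
  difference; what is left on each side has mass \<rho> = 1 - card A * \<eta> and can be paired off,
  each pair contributing at most \<open>D\<close>.\<close>

lemma norm_diff_convex_combinations_le:
  fixes x :: "'i \<Rightarrow> 'a::real_normed_vector"
    and \<eta> D :: real and a b :: "'i \<Rightarrow> real"
  assumes A: "finite A"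
    and a: "\<And>j. j \<in> A \<Longrightarrow> \<eta> \<le> a j" "sum a A = 1"
    and b: "\<And>j. j \<in> A \<Longrightarrow> \<eta> \<le> b j" "sum b A = 1"
    and D: "\<And>j l. j \<in> A \<Longrightarrow> l \<in> A \<Longrightarrow> norm (x j - x l) \<le> D"
  shows "norm ((\<Sum>j\<in>A. a j *\<^sub>R x j) - (\<Sum>j\<in>A. b j *\<^sub>R x j)) \<le> (1 - card A * \<eta>) * D"
proof -
  define \<rho> where "\<rho> = 1 - card A * \<eta>"
  define u v where "u j = a j - \<eta>" and "v j = b j - \<eta>" for j
  let ?d = "(\<Sum>j\<in>A. a j *\<^sub>R x j) - (\<Sum>j\<in>A. b j *\<^sub>R x j)"
  have uv: "0 \<le> u j" "0 \<le> v j" if "j \<in> A" for j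
    using a b that by (auto simp: u_def v_def)
  have sums: "sum u A = \<rho>" "sum v A = \<rho>"
    using a b by (simp_all add: u_def v_def \<rho>_def sum_subtractf)
  have \<rho>: "0 \<le> \<rho>"
    using sums(1) uv(1) by (metis sum_nonneg)
  have d: "?d = (\<Sum>j\<in>A. u j *\<^sub>R x j) - (\<Sum>j\<in>A. v j *\<^sub>R x j)"
    by (simp add: u_def v_def scaleR_diff_left sum_subtractf)
  \<comment> \<open>The extra factor \<rho> lets both sums be written over the same product weights
    v_l u_j, so that the difference becomes a sum of the differences x_j - x_l.\<close>
  have "\<rho> *\<^sub>R ?d = (\<Sum>l\<in>A. v l) *\<^sub>R (\<Sum>j\<in>A. u j *\<^sub>R x j) - (\<Sum>j\<in>A. u j) *\<^sub>R (\<Sum>l\<in>A. v l *\<^sub>R x l)"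
    by (simp only: d sums scaleR_diff_right)
  also have "\<dots> = (\<Sum>l\<in>A. \<Sum>j\<in>A. (v l * u j) *\<^sub>R x j) - (\<Sum>j\<in>A. \<Sum>l\<in>A. (v l * u j) *\<^sub>R x l)"
    by (simp only: scaleR_sum_left) (simp add: scaleR_sum_right mult.commute)
  also have "(\<Sum>j\<in>A. \<Sum>l\<in>A. (v l * u j) *\<^sub>R x l) = (\<Sum>l\<in>A. \<Sum>j\<in>A. (v l * u j) *\<^sub>R x l)"
    by (rule sum.swap)
  also have "(\<Sum>l\<in>A. \<Sum>j\<in>A. (v l * u j) *\<^sub>R x j) - \<dots> = (\<Sum>l\<in>A. \<Sum>j\<in>A. (v l * u j) *\<^sub>R (x j - x l))"
    by (simp only: scaleR_diff_right sum_subtractf)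
  finally have eq: "\<rho> *\<^sub>R ?d = (\<Sum>l\<in>A. \<Sum>j\<in>A. (v l * u j) *\<^sub>R (x j - x l))" .
  have "\<rho> * norm ?d = norm (\<rho> *\<^sub>R ?d)"
    using \<rho> by simp
  also have "\<dots> = norm (\<Sum>l\<in>A. \<Sum>j\<in>A. (v l * u j) *\<^sub>R (x j - x l))"
    by (simp only: eq)
  also have "\<dots> \<le> (\<Sum>l\<in>A. \<Sum>j\<in>A. v l * u j * D)"
    using uv D by (intro order_trans[OF norm_sum] sum_mono) (simp add: mult_left_mono)
  also have "\<dots> = (\<Sum>l\<in>A. v l) * (\<Sum>j\<in>A. u j) * D"
    by (simp only: sum_product) (simp only: sum_distrib_right)
  also have "\<dots> = \<rho> * (\<rho> * D)"
    by (simp add: sums)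
  finally have le: "\<rho> * norm ?d \<le> \<rho> * (\<rho> * D)" .
  show ?thesis
  proof (cases "\<rho> = 0")
    \<comment> \<open>Division by \<rho> is impossible here, but then all remaining weights vanish
      and the two combinations coincide.\<close>
    case True
    then have "u j = 0" "v j = 0" if "j \<in> A" for j
      using sums uv A that by (auto simp: sum_nonneg_eq_0_iff)
    then show ?thesis
      using True by (simp add: d \<rho>_def[symmetric])
  next
    case False
    then show ?thesis
      using le \<rho> by (simp add: \<rho>_def[symmetric])
  qed
qed

locale consensus_graph =
  fixes n :: nat and E :: "nat \<Rightarrow> (nat \<times> nat) set" and W :: "nat \<Rightarrow> nat \<Rightarrow> nat \<Rightarrow> real"
    and w :: real and B :: nat
  assumes graph: "graph_assumption n E W w B"
    and n_pos: "1 \<le> n" and w_pos: "0 < w" and B_pos: "0 < B"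
begin

section \<open>Mixing matrices and their products\<close>

lemma weight_nonneg: "1 \<le> t \<Longrightarrow> i \<in> {1..n} \<Longrightarrow> j \<in> {1..n} \<Longrightarrow> 0 \<le> W t i j"
  using graph unfolding graph_assumption_def by (metis less_eq_real_def)

lemma weight_ge:
  assumes "1 \<le> t" "i \<in> {1..n}" "j \<in> {1..n}" "(j, i) \<in> E t \<or> i = j"
  shows "w \<le> W t i j"
  using graph assms unfolding graph_assumption_def by metis

lemma weight_row_sum: "1 \<le> t \<Longrightarrow> i \<in> {1..n} \<Longrightarrow> (\<Sum>j\<in>{1..n}. W t i j) = 1"
  and weight_column_sum: "1 \<le> t \<Longrightarrow> j \<in> {1..n} \<Longrightarrow> (\<Sum>i\<in>{1..n}. W t i j) = 1"
  using graph unfolding graph_assumption_def by metis+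

lemma edges_subset: "1 \<le> t \<Longrightarrow> E t \<subseteq> {1..n} \<times> {1..n}"
  using graph unfolding graph_assumption_def by metis

lemma window_connected:
  "1 \<le> t \<Longrightarrow> strongly_connected_on {1..n} (\<Union>l\<in>{0..B - 1}. E (t + l))"
  using graph unfolding graph_assumption_def by metis

lemma transition_nonneg: "1 \<le> s \<Longrightarrow> i \<in> {1..n} \<Longrightarrow> 0 \<le> transition n W s k i j"
  by (induction k arbitrary: i) (auto intro!: sum_nonneg mult_nonneg_nonneg weight_nonneg)

lemma transition_row_sum: "1 \<le> s \<Longrightarrow> i \<in> {1..n} \<Longrightarrow> (\<Sum>j\<in>{1..n}. transition n W s k i j) = 1"
proof (induction k arbitrary: i)
  case (Suc k)
  have "(\<Sum>j\<in>{1..n}. transition n W s (Suc k) i j)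
      = (\<Sum>l\<in>{1..n}. \<Sum>j\<in>{1..n}. W (s + k) i l * transition n W s k l j)"
    by (simp only: transition.simps) (rule sum.swap)
  also have "\<dots> = (\<Sum>l\<in>{1..n}. W (s + k) i l)"
    using Suc by (simp flip: sum_distrib_left)
  finally show ?case
    using weight_row_sum Suc.prems by simp
qed auto

text \<open>A single path through \<open>l\<close> already gives the lower bound; following an edge
  or a self-loop costs one factor \<open>w\<close>.\<close>

lemma transition_step_ge:
  assumes "1 \<le> s" "i \<in> {1..n}" "l \<in> {1..n}" "(l, i) \<in> E (s + k) \<or> i = l"
    and "w ^ k \<le> transition n W s k l j"
  shows "w ^ Suc k \<le> transition n W s (Suc k) i j"
proof -
  have "w ^ Suc k \<le> W (s + k) i l * transition n W s k l j"
    using assms w_pos weight_ge[of "s + k" i l] weight_nonneg[of "s + k" i l]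
    by (simp add: mult_mono)
  also have "\<dots> \<le> (\<Sum>l\<in>{1..n}. W (s + k) i l * transition n W s k l j)"
    using assms by (intro member_le_sum) (auto intro!: mult_nonneg_nonneg weight_nonneg transition_nonneg)
  finally show ?thesis by simp
qed

text \<open>Track the set \<open>S k\<close> of agents that carry weight at least w^k of agent j's
  value. Self-loops make it increasing. If it stalls over one window of length \<open>B\<close>, it
  is closed under all edges of that window, hence is everything by strong connectivity. So it gains
  an agent in each window until it is full, and n windows suffice.\<close>

lemma transition_window_ge:
  assumes s: "1 \<le> s" and j: "j \<in> {1..n}"
  shows "\<forall>i\<in>{1..n}. w ^ (n * B) \<le> transition n W s (n * B) i j"
proof -
  define S where "S k = {i \<in> {1..n}. w ^ k \<le> transition n W s k i j}" for k
  have fin: "finite (S k)" for k by (simp add: S_def)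
  have step: "i \<in> S (Suc k)" if "l \<in> S k" "i \<in> {1..n}" "(l, i) \<in> E (s + k) \<or> i = l" for i l k
    using transition_step_ge[OF s, of i l k j] that by (simp add: S_def)
  have mono: "S k \<subseteq> S (k + c)" for k c
    by (induction c) (auto intro: step simp: S_def[of k] dest!: subsetD)
  have j0: "j \<in> S k" for k
    using mono[of 0 k] j by (auto simp: S_def)
  have full: "S k = {1..n}" if const: "S (k + B) = S k" for k
  proof -
    let ?U = "\<Union>l\<in>{0..B - 1}. E (s + k + l)"
    have closed: "v \<in> S k" if "u \<in> S k" "(u, v) \<in> ?U" for u v
    proof -
      obtain l where l: "l \<le> B - 1" "(u, v) \<in> E (s + (k + l))"
        using \<open>(u, v) \<in> ?U\<close> by (auto simp: add.assoc)
      have "u \<in> S (k + l)"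
        using mono \<open>u \<in> S k\<close> by blast
      moreover have "v \<in> {1..n}"
        using edges_subset[of "s + (k + l)"] l(2) s by auto
      ultimately have "v \<in> S (Suc (k + l))"
        using step l(2) by blast
      \<comment> \<open>An edge used at offset l \<le> B - 1 takes effect at time k + l + 1, which
        is still within the window.\<close>
      also have "\<dots> \<subseteq> S (k + B)"
        using mono[of "Suc (k + l)" "B - Suc l"] l(1) B_pos by simp
      finally show ?thesis
        using const by simp
    qed
    have "i \<in> S k" if "i \<in> {1..n}" for i
    proof -
      have "(j, i) \<in> ?U\<^sup>*"
        using window_connected[of "s + k"] s j that by (simp add: strongly_connected_on_def)
      then show ?thesis
        by (induction rule: rtrancl_induct) (use j0 closed in blast)+
    qed
    then show ?thesis by (auto simp: S_def)
  qed
  \<comment> \<open>The strict inequality starts from \<open>j\<close> itself at c = 0. At c = n the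
    second alternative would need more than n agents.\<close>
  have card: "S (c * B) = {1..n} \<or> c < card (S (c * B))" for c
  proof (induction c)
    case 0
    then show ?case using j0[of 0] fin[of 0] by (auto simp: card_gt_0_iff)
  next
    case (Suc c)
    have sub: "S (c * B) \<subseteq> S (Suc c * B)"
      using mono[of "c * B" B] by (simp add: add.commute)
    have le: "S (Suc c * B) \<subseteq> {1..n}" by (auto simp: S_def)
    show ?case
    proof (cases "S (c * B) = {1..n}")
      case True
      then show ?thesis using sub le by blast
    next
      case False
      then have "S (c * B) \<noteq> S (Suc c * B)"
        using full[of "c * B"] by (metis add.commute mult_Suc)
      then have "card (S (c * B)) < card (S (Suc c * B))"
        using sub fin by (intro psubset_card_mono) auto
      then show ?thesis using Suc False by simp
    qed
  qed
  have "S (n * B) \<subseteq> {1..n}"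
    by (auto simp: S_def)
  then have "card (S (n * B)) \<le> n"
    using card_mono[of "{1..n}" "S (n * B)"] by simp
  then have "S (n * B) = {1..n}"
    using card[of n] by simp
  then show ?thesis by (auto simp: S_def)
qed

text \<open>The row sums make each term a convex combination, to which Jensen applies; after
  exchanging the sums the column sums remove the weights.\<close>

lemma sum_norm_mixed_square_le:
  fixes y :: "'b::real_inner" and u :: "nat \<Rightarrow> 'b"
  assumes t: "1 \<le> t"
  shows "(\<Sum>i\<in>{1..n}. (norm ((\<Sum>j\<in>{1..n}. W t i j *\<^sub>R u j) - y))\<^sup>2) \<le> (\<Sum>j\<in>{1..n}. (norm (u j - y))\<^sup>2)"
proof -
  have "(\<Sum>i\<in>{1..n}. (norm ((\<Sum>j\<in>{1..n}. W t i j *\<^sub>R u j) - y))\<^sup>2)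
      \<le> (\<Sum>i\<in>{1..n}. \<Sum>j\<in>{1..n}. W t i j * (norm (u j - y))\<^sup>2)"
    using weight_nonneg weight_row_sum t by (intro sum_mono norm_convex_combination_square_le) auto
  also have "\<dots> = (\<Sum>j\<in>{1..n}. (\<Sum>i\<in>{1..n}. W t i j) * (norm (u j - y))\<^sup>2)"
    by (subst sum.swap) (simp add: sum_distrib_right)
  also have "\<dots> = (\<Sum>j\<in>{1..n}. (norm (u j - y))\<^sup>2)"
    using weight_column_sum t by simp
  finally show ?thesis .
qed

text \<open>The mass common to all rows of an n B-step product: each of its n columns has entries at
  least w^(n B).\<close>

definition contraction_gap :: real
  where "contraction_gap = n * w ^ (n * B)"

lemma contraction_gap_pos: "0 < contraction_gap"
  using n_pos w_pos by (simp add: contraction_gap_def)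

end

section \<open>Averaging with perturbations\<close>

locale perturbed_consensus = consensus_graph +
  fixes x :: "nat \<Rightarrow> nat \<Rightarrow> 'a::real_normed_vector"
begin

definition mixed :: "nat \<Rightarrow> nat \<Rightarrow> 'a"
  where "mixed i t = (\<Sum>j\<in>{1..n}. W t i j *\<^sub>R x j t)"

definition residual :: "nat \<Rightarrow> nat \<Rightarrow> 'a"
  where "residual i t = x i (t + 1) - mixed i t"

definition total_residual :: "nat \<Rightarrow> real"
  where "total_residual t = (\<Sum>i\<in>{1..n}. norm (residual i t))"

definition spread :: "nat \<Rightarrow> real"
  where "spread t = Max ((\<lambda>(i, j). norm (x i t - x j t)) ` ({1..n} \<times> {1..n}))"

lemma norm_diff_le_spread: "i \<in> {1..n} \<Longrightarrow> j \<in> {1..n} \<Longrightarrow> norm (x i t - x j t) \<le> spread t"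
  unfolding spread_def by (rule Max_ge) auto

lemma spread_le:
  assumes "\<And>i j. i \<in> {1..n} \<Longrightarrow> j \<in> {1..n} \<Longrightarrow> norm (x i t - x j t) \<le> c"
  shows "spread t \<le> c"
  unfolding spread_def by (rule Max.boundedI) (use assms n_pos in auto)

lemma spread_nonneg: "0 \<le> spread t"
  using norm_diff_le_spread[of 1 1 t] n_pos by simp

lemma total_residual_nonneg: "0 \<le> total_residual t"
  by (simp add: total_residual_def sum_nonneg)

lemma norm_residual_le: "i \<in> {1..n} \<Longrightarrow> norm (residual i t) \<le> total_residual t"
  unfolding total_residual_def by (rule member_le_sum) auto

text \<open>Unrolling the recursion: each step adds its own residual, and averaging with weights of
  sum one does not amplify the errors collected before.\<close>

lemma transition_evolution:
  assumes s: "1 \<le> s" and i: "i \<in> {1..n}"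
  shows "norm (x i (s + k) - (\<Sum>j\<in>{1..n}. transition n W s k i j *\<^sub>R x j s))
    \<le> (\<Sum>r<k. total_residual (s + r))"
  using i
proof (induction k arbitrary: i)
  case 0
  then show ?case
    by (simp add: if_distrib[of "\<lambda>c. c *\<^sub>R _"] cong: if_cong)
next
  case (Suc k)
  let ?y = "\<lambda>k i. \<Sum>j\<in>{1..n}. transition n W s k i j *\<^sub>R x j s"
  have "?y (Suc k) i = (\<Sum>l\<in>{1..n}. \<Sum>j\<in>{1..n}. (W (s + k) i l * transition n W s k l j) *\<^sub>R x j s)"
    by (simp add: scaleR_sum_left) (rule sum.swap)
  also have "\<dots> = (\<Sum>l\<in>{1..n}. W (s + k) i l *\<^sub>R ?y k l)"
    by (simp add: scaleR_sum_right)
  finally have "x i (s + Suc k) - ?y (Suc k) i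
      = residual i (s + k) + (\<Sum>l\<in>{1..n}. W (s + k) i l *\<^sub>R (x l (s + k) - ?y k l))"
    by (simp add: residual_def mixed_def scaleR_diff_right sum_subtractf)
  then have "norm (x i (s + Suc k) - ?y (Suc k) i)
      \<le> norm (residual i (s + k)) + norm (\<Sum>l\<in>{1..n}. W (s + k) i l *\<^sub>R (x l (s + k) - ?y k l))"
    by (simp only: norm_triangle_ineq)
  also have "\<dots> \<le> total_residual (s + k) + (\<Sum>l\<in>{1..n}. W (s + k) i l * (\<Sum>r<k. total_residual (s + r)))"
    using Suc s by (intro add_mono norm_residual_le order_trans[OF norm_sum] sum_mono)
      (auto simp: weight_nonneg intro!: mult_left_mono)
  also have "\<dots> = (\<Sum>r<Suc k. total_residual (s + r))"
    using weight_row_sum[of "s + k" i] s Suc.prems by (simp flip: sum_distrib_right)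
  finally show ?case .
qed

text \<open>Both agents are compared with the unperturbed evolution over n B steps, which contracts;
  the factor 2 counts the deviation of each of them.\<close>

lemma spread_contraction:
  assumes s: "1 \<le> s"
  shows "spread (s + n * B) \<le> (1 - contraction_gap) * spread s + 2 * (\<Sum>r<n * B. total_residual (s + r))"
proof (rule spread_le)
  fix i j assume ij: "i \<in> {1..n}" "j \<in> {1..n}"
  let ?K = "n * B"
  let ?y = "\<lambda>i. \<Sum>j\<in>{1..n}. transition n W s ?K i j *\<^sub>R x j s"
  let ?e = "\<Sum>r<?K. total_residual (s + r)"
  have "norm (?y i - ?y j) \<le> (1 - card {1..n} * w ^ ?K) * spread s"
    using transition_window_ge[OF s] transition_row_sum[OF s] ij norm_diff_le_spread
    by (intro norm_diff_convex_combinations_le) auto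
  then have y: "norm (?y i - ?y j) \<le> (1 - contraction_gap) * spread s"
    by (simp add: contraction_gap_def)
  have triangle: "norm (a - b) \<le> norm (c - d) + (norm (a - c) + norm (b - d))" for a b c d :: 'a
    using norm_triangle_ineq4[of "a - c" "b - d"] norm_triangle_ineq[of "c - d" "(a - c) - (b - d)"]
    by (simp add: algebra_simps)
  have "norm (x i (s + ?K) - x j (s + ?K))
      \<le> norm (?y i - ?y j) + (norm (x i (s + ?K) - ?y i) + norm (x j (s + ?K) - ?y j))"
    by (rule triangle)
  also have "\<dots> \<le> (1 - contraction_gap) * spread s + (?e + ?e)"
    by (rule add_mono[OF y add_mono[OF transition_evolution[OF s ij(1)] transition_evolution[OF s ij(2)]]])
  finally show "norm (x i (s + ?K) - x j (s + ?K)) \<le> (1 - contraction_gap) * spread s + 2 * ?e"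
    by simp
qed

text \<open>Sum the contraction over all starting times. The first n B times have no predecessor and
  are bounded by \<open>c\<close>; each residual lies in at most n B windows. Moving the contracted
  sum to the left leaves the factor \<open>contraction_gap\<close>.\<close>

lemma sum_spread_le:
  fixes c :: real
  assumes c: "\<And>t. 1 \<le> t \<Longrightarrow> spread t \<le> c" "0 \<le> c"
  shows "contraction_gap * (\<Sum>t\<in>{1..T}. spread t)
    \<le> n * B * c + 2 * (n * B) * (\<Sum>t\<in>{1..T}. total_residual t)"
proof -
  let ?K = "n * B"
  let ?D = "\<Sum>t\<in>{1..T}. spread t" and ?R = "\<Sum>t\<in>{1..T}. total_residual t"
  \<comment> \<open>This makes 1 - \<open>contraction_gap\<close> nonnegative, which is needed to
    enlarge the sum it multiplies to the full range of times.\<close>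
  have gap: "contraction_gap \<le> 1"
  proof -
    have "(\<Sum>j\<in>{1..n}. w ^ ?K) \<le> (\<Sum>j\<in>{1..n}. transition n W 1 ?K 1 j)"
      using transition_window_ge[of 1] n_pos by (intro sum_mono) auto
    then show ?thesis
      using transition_row_sum[of 1 1 ?K] n_pos by (simp add: contraction_gap_def)
  qed
  \<comment> \<open>An inclusion only: for T below n B the truncated difference makes the shifted
    part empty.\<close>
  have sub: "{1..T} \<subseteq> {1..?K} \<union> (\<lambda>s. s + ?K) ` {1..T - ?K}"
  proof
    fix t assume t: "t \<in> {1..T}"
    show "t \<in> {1..?K} \<union> (\<lambda>s. s + ?K) ` {1..T - ?K}"
    proof (cases "t \<le> ?K")
      case False
      with t have "t = (t - ?K) + ?K" "t - ?K \<in> {1..T - ?K}" by auto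
      then show ?thesis by blast
    qed (use t in auto)
  qed
  have R: "(\<Sum>s\<in>{1..T - ?K}. total_residual (s + r)) \<le> ?R" if "r < ?K" for r
  proof -
    have "(\<Sum>s\<in>{1..T - ?K}. total_residual (s + r)) = (\<Sum>t\<in>(\<lambda>s. s + r) ` {1..T - ?K}. total_residual t)"
      by (subst sum.reindex) (auto simp: inj_on_def)
    also have "\<dots> \<le> ?R"
      using that by (intro sum_mono2) (auto simp: total_residual_nonneg)
    finally show ?thesis .
  qed
  have "?D \<le> (\<Sum>t\<in>{1..?K} \<union> (\<lambda>s. s + ?K) ` {1..T - ?K}. spread t)"
    using sub by (intro sum_mono2) (auto simp: spread_nonneg)
  also have "\<dots> \<le> (\<Sum>t\<in>{1..?K}. spread t) + (\<Sum>t\<in>(\<lambda>s. s + ?K) ` {1..T - ?K}. spread t)"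
    by (simp add: sum.union_inter[symmetric] sum_nonneg spread_nonneg)
  also have "(\<Sum>t\<in>(\<lambda>s. s + ?K) ` {1..T - ?K}. spread t) = (\<Sum>s\<in>{1..T - ?K}. spread (s + ?K))"
    by (subst sum.reindex) (auto simp: inj_on_def)
  also have "\<dots> \<le> (\<Sum>s\<in>{1..T - ?K}. (1 - contraction_gap) * spread s + 2 * (\<Sum>r<?K. total_residual (s + r)))"
    by (intro sum_mono spread_contraction) auto
  also have "\<dots> = (1 - contraction_gap) * (\<Sum>s\<in>{1..T - ?K}. spread s)
      + 2 * (\<Sum>r<?K. \<Sum>s\<in>{1..T - ?K}. total_residual (s + r))"
    by (subst sum.swap) (simp add: sum.distrib sum_distrib_left)
  also have "\<dots> \<le> (1 - contraction_gap) * ?D + 2 * (\<Sum>r<?K. ?R)"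
    using gap R by (intro add_mono mult_left_mono sum_mono sum_mono2) (auto simp: spread_nonneg)
  also have "(\<Sum>t\<in>{1..?K}. spread t) \<le> (\<Sum>t\<in>{1..?K}. c)"
    by (intro sum_mono c) auto
  finally show ?thesis
    by (simp add: algebra_simps)
qed

text \<open>Averaging moves an agent by a convex combination of differences to the others, hence by
  at most the spread; the rest of the step is the residual.\<close>

lemma norm_step_le:
  assumes "1 \<le> t" and i: "i \<in> {1..n}"
  shows "norm (x i (t + 1) - x i t) \<le> norm (residual i t) + spread t"
proof -
  have "mixed i t - x i t = (\<Sum>j\<in>{1..n}. W t i j *\<^sub>R (x j t - x i t))"
    using weight_row_sum[OF assms]
    by (simp add: mixed_def scaleR_diff_right sum_subtractf flip: scaleR_sum_left)
  also have "norm \<dots> \<le> (\<Sum>j\<in>{1..n}. W t i j * spread t)"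
    using assms norm_diff_le_spread
    by (intro order_trans[OF norm_sum] sum_mono) (auto simp: weight_nonneg intro!: mult_left_mono)
  also have "\<dots> = spread t"
    using weight_row_sum[OF assms] by (simp flip: sum_distrib_right)
  finally have "norm (mixed i t - x i t) \<le> spread t" .
  then have "norm (residual i t) + norm (mixed i t - x i t) \<le> norm (residual i t) + spread t"
    by simp
  moreover have "x i (t + 1) - x i t = residual i t + (mixed i t - x i t)"
    by (simp add: residual_def)
  ultimately show ?thesis
    using norm_triangle_ineq order_trans by metis
qed

end

section \<open>The primal-dual iteration\<close>

text \<open>The step sizes enter through inequalities only. \<open>\<beta>_\<gamma>_le_one\<close>
  keeps the damping factor of the dual update nonnegative, and \<open>inverse_\<gamma>_step\<close>
  controls the error made when dual increments with weights 1/\<gamma> are summed.\<close>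

locale primal_dual_iteration = consensus_graph +
  fixes p :: nat and ms :: "nat \<Rightarrow> nat" and X :: "fsvec set"
    and f :: loss and g :: constr and df :: loss_subgrad and dg :: constr_subgrad
    and r R F1 F2 :: real and \<alpha> \<beta> \<gamma> :: "nat \<Rightarrow> real" and x q :: "nat \<Rightarrow> nat \<Rightarrow> fsvec"
  assumes function_assms: "function_assumption p n ms X f g df dg r R F1 F2"
    and algorithm: "generated_by_algorithm n ms X g df dg W \<alpha> \<beta> \<gamma> x q"
    and \<alpha>_pos: "\<And>t. 1 \<le> t \<Longrightarrow> 0 < \<alpha> t" and \<alpha>_antimono: "\<And>t. 1 \<le> t \<Longrightarrow> \<alpha> (t + 1) \<le> \<alpha> t"
    and \<beta>_pos: "\<And>t. 1 \<le> t \<Longrightarrow> 0 < \<beta> t" and \<beta>_antimono: "\<And>t. 1 \<le> t \<Longrightarrow> \<beta> (t + 1) \<le> \<beta> t"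
    and \<gamma>_pos: "\<And>t. 1 \<le> t \<Longrightarrow> 0 < \<gamma> t" and \<gamma>_antimono: "\<And>t. 1 \<le> t \<Longrightarrow> \<gamma> (t + 1) \<le> \<gamma> t"
    and \<beta>_\<gamma>_le_one: "\<And>t. 1 \<le> t \<Longrightarrow> \<beta> t * \<gamma> t \<le> 1"
    and inverse_\<gamma>_step: "\<And>t. 1 \<le> t \<Longrightarrow> 1 / \<gamma> (t + 1) - 1 / \<gamma> t \<le> \<beta> (t + 1)"

sublocale primal_dual_iteration \<subseteq> perturbed_consensus n E W w B x ..

context primal_dual_iteration
begin

lemma X_convex: "convex X" and R_pos: "0 < R"
  and norm_X_le: "y \<in> X \<Longrightarrow> norm y \<le> R"
  using function_assms unfolding function_assumption_def by auto

lemma X_compact: "compact X"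
  using function_assms compact_subset_Rn unfolding function_assumption_def by metis

lemma norm_diff_X_le: "u \<in> X \<Longrightarrow> v \<in> X \<Longrightarrow> norm (u - v) \<le> 2 * R"
  using norm_triangle_ineq4[of u v] norm_X_le[of u] norm_X_le[of v] by linarith

lemma iterate_init: "i \<in> {1..n} \<Longrightarrow> x i 1 \<in> X" "i \<in> {1..n} \<Longrightarrow> q i 1 = 0"
  using algorithm unfolding generated_by_algorithm_def by auto

lemma X_nonempty: "X \<noteq> {}"
  using iterate_init(1)[of 1] n_pos by auto

context
  fixes i t :: nat
  assumes i: "i \<in> {1..n}" and t: "1 \<le> t"
begin

lemma g_Rn: "y \<in> X \<Longrightarrow> g i t y \<in> Rn (ms i)"
  and loss_diff_le: "y \<in> X \<Longrightarrow> u \<in> X \<Longrightarrow> \<bar>f i t y - f i t u\<bar> \<le> F1"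
  and norm_g_le: "y \<in> X \<Longrightarrow> norm (g i t y) \<le> F1"
  and df_subgradient: "y \<in> X \<Longrightarrow> is_subgradient p X (f i t) y (df i t y)"
  and dg_subgradient:
    "y \<in> X \<Longrightarrow> k \<in> {1..ms i} \<Longrightarrow> is_subgradient p X (\<lambda>u. coord (g i t u) k) y (dg i t y k)"
  and norm_df_le: "y \<in> X \<Longrightarrow> norm (df i t y) \<le> F2"
  and mat_norm_dg_le: "y \<in> X \<Longrightarrow> mat_norm (ms i) (dg i t y) \<le> F2"
  using function_assms i t unfolding function_assumption_def by blast+

lemma loss_subgradient: "y \<in> X \<Longrightarrow> u \<in> X \<Longrightarrow> f i t y - f i t u \<le> inner (df i t y) (y - u)"
  using df_subgradient[of y] inner_diff_right[of "df i t y"]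
  unfolding is_subgradient_def by fastforce

end

lemma F1_nonneg: "0 \<le> F1"
  using loss_diff_le[of 1 1 "x 1 1" "x 1 1"] iterate_init(1)[of 1] n_pos by simp

lemma F2_nonneg: "0 \<le> F2"
  using order_trans[OF norm_ge_zero norm_df_le[of 1 1 "x 1 1"]] iterate_init(1)[of 1] n_pos by simp

section \<open>Linearised constraints and the one-step inequality\<close>

definition slope :: "nat \<Rightarrow> nat \<Rightarrow> fsvec \<Rightarrow> fsvec \<Rightarrow> fsvec"
  where "slope i t y v = transpose_mat_vec (ms i) (dg_pos g dg i t y) v"

text \<open>The positive part of a convex function is convex, and the columns selected by
  \<open>dg_pos\<close> are subgradients of it: zero where the constraint is negative, the given one
  elsewhere.\<close>

lemma slope_subgradient:
  assumes i: "i \<in> {1..n}" and t: "1 \<le> t" and y: "y \<in> X" and u: "u \<in> X"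
  shows "coord (pos_part (g i t y)) k + coord (slope i t y (u - y)) k \<le> coord (pos_part (g i t u)) k"
proof (cases "k \<in> {1..ms i}")
  case True
  then show ?thesis
    using dg_subgradient[OF i t y True] u
    by (auto simp: slope_def transpose_mat_vec_def dg_pos_def is_subgradient_def max_def dest!: bspec[of _ _ u])
next
  case False
  \<comment> \<open>Outside the block everything vanishes. The inequality is wanted for every index
    because the coordinatewise comparisons of norms and inner products range over all of
    them.\<close>
  then have "coord (g i t y) k = 0" "coord (g i t u) k = 0" "coord (slope i t y (u - y)) k = 0"
    using g_Rn[OF i t y] g_Rn[OF i t u] by (auto simp: slope_def transpose_mat_vec_def Rn_def)
  then show ?thesis by simp
qed

text \<open>Replacing columns by zero only deletes coordinates of the transposed product, so the
  bound on the full subgradient matrix carries over.\<close>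

lemma norm_slope_le:
  assumes i: "i \<in> {1..n}" and t: "1 \<le> t" and y: "y \<in> X"
  shows "norm (slope i t y v) \<le> F2 * norm v"
proof -
  have "norm (slope i t y v) \<le> norm (transpose_mat_vec (ms i) (dg i t y) v)"
    by (rule norm_fsvec_mono) (simp add: slope_def transpose_mat_vec_def dg_pos_def)
  also have "\<dots> \<le> mat_norm (ms i) (dg i t y) * norm v"
    by (rule norm_transpose_mat_vec_le)
  also have "\<dots> \<le> F2 * norm v"
    using mat_norm_dg_le[OF i t y] by (rule mult_right_mono) simp
  finally show ?thesis .
qed

definition violation :: "nat \<Rightarrow> nat \<Rightarrow> fsvec"
  where "violation i t = pos_part (g i t (x i t))"

definition dual_input :: "nat \<Rightarrow> nat \<Rightarrow> fsvec"
  where "dual_input i t = violation i t + slope i t (x i t) (x i (t + 1) - x i t)"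

definition direction :: "nat \<Rightarrow> nat \<Rightarrow> fsvec"
  where "direction i t = df i t (x i t) + mat_vec (ms i) (dg_pos g dg i t (x i t)) (q i t)"

lemma x_step:
  assumes "i \<in> {1..n}" and "1 \<le> t"
  shows "x i (t + 1) = proj X (mixed i t - \<alpha> (t + 1) *\<^sub>R direction i t)"
  using algorithm assms
  unfolding generated_by_algorithm_def Let_def mixed_def direction_def by blast

lemma q_step:
  assumes "i \<in> {1..n}" and "1 \<le> t"
  shows "q i (t + 1) = pos_part ((1 - \<beta> (t + 1) * \<gamma> (t + 1)) *\<^sub>R q i t + \<gamma> (t + 1) *\<^sub>R dual_input i t)"
  using algorithm assms
  unfolding generated_by_algorithm_def Let_def dual_input_def violation_def slope_def by blast

lemma x_in_X:
  assumes i: "i \<in> {1..n}" and t: "1 \<le> t"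
  shows "x i t \<in> X"
  using t
proof (induction t rule: dec_induct)
  case base
  show ?case using iterate_init i by simp
next
  case (step t)
  then show ?case
    using x_step[OF i] proj_closest(1)[OF X_compact X_nonempty] by simp
qed

lemma spread_le_diameter: "1 \<le> t \<Longrightarrow> spread t \<le> 2 * R"
  by (intro spread_le norm_diff_X_le x_in_X) auto

lemma q_nonneg:
  assumes i: "i \<in> {1..n}" and t: "1 \<le> t"
  shows "0 \<le> coord (q i t) k"
  using t
proof (induction t rule: dec_induct)
  case base
  show ?case using iterate_init i by simp
next
  case (step t)
  then show ?case using q_step[OF i] by simp
qed

text \<open>The subgradient inequality keeps the dual input below the violation at the next iterate, so
  that the damping term \<open>\<beta> \<gamma>\<close> balances the input at the level \<open>F1 / \<beta>\<close>.\<close>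

lemma damped_dual_bound:
  assumes i: "i \<in> {1..n}" and t: "1 \<le> t"
  shows "\<beta> t * norm (q i t) \<le> F1"
  using t
proof (induction t rule: dec_induct)
  case base
  show ?case using iterate_init i F1_nonneg by simp
next
  case (step t)
  note t = \<open>1 \<le> t\<close>
  define b c where "b = \<beta> (t + 1)" and "c = \<gamma> (t + 1)"
  have bc: "0 < b" "0 < c" "b * c \<le> 1" "b \<le> \<beta> t"
    using \<beta>_pos[of "t + 1"] \<gamma>_pos[of "t + 1"] \<beta>_\<gamma>_le_one[of "t + 1"] \<beta>_antimono[OF t]
    by (auto simp: b_def c_def)
  have xs: "x i t \<in> X" "x i (t + 1) \<in> X"
    using x_in_X i t by auto
  let ?v = "pos_part (g i t (x i (t + 1)))"
  have "norm (q i (t + 1)) \<le> norm ((1 - b * c) *\<^sub>R q i t + c *\<^sub>R ?v)"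
  proof (rule norm_fsvec_mono)
    fix k
    have "c * coord (dual_input i t) k \<le> c * coord ?v k"
      using slope_subgradient[OF i t xs, of k] bc
      by (intro mult_left_mono) (auto simp: dual_input_def violation_def)
    moreover have "0 \<le> (1 - b * c) * coord (q i t) k"
      using bc q_nonneg[OF i t] by (intro mult_nonneg_nonneg) auto
    moreover have "0 \<le> c * coord ?v k"
      using bc by (intro mult_nonneg_nonneg) auto
    ultimately show "\<bar>coord (q i (t + 1)) k\<bar> \<le> \<bar>coord ((1 - b * c) *\<^sub>R q i t + c *\<^sub>R ?v) k\<bar>"
      unfolding q_step[OF i t] b_def[symmetric] c_def[symmetric] coord_pos_part coord_add coord_scaleR
      by linarith
  qed
  also have "\<dots> \<le> (1 - b * c) * norm (q i t) + c * F1"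
  proof -
    have "norm ?v \<le> F1"
      using norm_pos_part_le norm_g_le[OF i t xs(2)] order_trans by blast
    have "norm ((1 - b * c) *\<^sub>R q i t + c *\<^sub>R ?v) \<le> (1 - b * c) * norm (q i t) + c * norm ?v"
      using norm_triangle_ineq[of "(1 - b * c) *\<^sub>R q i t" "c *\<^sub>R ?v"] bc by simp
    also have "\<dots> \<le> (1 - b * c) * norm (q i t) + c * F1"
      using \<open>norm ?v \<le> F1\<close> bc by (intro add_left_mono mult_left_mono) auto
    finally show ?thesis .
  qed
  \<comment> \<open>Scaled by \<beta>, the recursion is bounded by a convex combination of \<beta>
    |q| and F1, so the level F1 is preserved.\<close>
  finally have "b * norm (q i (t + 1)) \<le> b * ((1 - b * c) * norm (q i t) + c * F1)"
    using bc by (simp del: distrib_left_numeral)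
  also have "\<dots> = (1 - b * c) * (b * norm (q i t)) + b * c * F1"
    by (simp add: algebra_simps)
  also have "\<dots> \<le> (1 - b * c) * F1 + b * c * F1"
  proof -
    have "b * norm (q i t) \<le> \<beta> t * norm (q i t)"
      using bc by (intro mult_right_mono) auto
    then have "b * norm (q i t) \<le> F1"
      using step.IH by simp
    then show ?thesis
      using bc by (intro add_right_mono mult_left_mono) auto
  qed
  also have "\<dots> = F1"
    by (simp add: algebra_simps)
  finally show ?case by (simp add: b_def)
qed

text \<open>Bounds \<open>dual_input\<close> minus \<beta> q: F1 for the violation, F2 times the
  diameter bound 2 R for the linear term, and another F1 for the damping term.\<close>

definition input_bound :: real
  where "input_bound = 2 * F1 + 2 * F2 * R"

text \<open>Before its positive part is taken, the update is q + \<gamma> u with u =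
  \<open>dual_input\<close> - \<beta> q. Taking positive parts does not increase the norm, and
  \<open>damped_dual_bound\<close> keeps u bounded, so expanding the square leaves only a
  second-order term of size \<gamma>.\<close>

lemma dual_drift:
  assumes i: "i \<in> {1..n}" and t: "1 \<le> t"
  shows "((norm (q i (t + 1)))\<^sup>2 - (norm (q i t))\<^sup>2) / (2 * \<gamma> (t + 1))
    \<le> inner (q i t) (dual_input i t) - \<beta> (t + 1) * (norm (q i t))\<^sup>2 + \<gamma> (t + 1) * input_bound\<^sup>2 / 2"
proof -
  define b c u where "b = \<beta> (t + 1)" and "c = \<gamma> (t + 1)" and "u = dual_input i t - b *\<^sub>R q i t"
  have bc: "0 < b" "0 < c" "b \<le> \<beta> t"
    using \<beta>_pos[of "t + 1"] \<gamma>_pos[of "t + 1"] \<beta>_antimono[OF t] by (auto simp: b_def c_def)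
  have xs: "x i t \<in> X" "x i (t + 1) \<in> X"
    using x_in_X i t by auto
  have "norm (slope i t (x i t) (x i (t + 1) - x i t)) \<le> F2 * (2 * R)"
    using norm_slope_le[OF i t xs(1)] norm_diff_X_le[OF xs(2,1)] F2_nonneg
    by (meson mult_left_mono order_trans)
  moreover have "norm (violation i t) \<le> F1"
    unfolding violation_def using norm_pos_part_le norm_g_le[OF i t xs(1)] order_trans by blast
  moreover have "norm (b *\<^sub>R q i t) \<le> F1"
  proof -
    have "b * norm (q i t) \<le> \<beta> t * norm (q i t)"
      using bc by (intro mult_right_mono) auto
    then show ?thesis
      using damped_dual_bound[OF i t] bc by simp
  qed
  moreover have "norm u \<le> norm (dual_input i t) + norm (b *\<^sub>R q i t)"
    unfolding u_def by (rule norm_triangle_ineq4)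
  moreover have "norm (dual_input i t)
      \<le> norm (violation i t) + norm (slope i t (x i t) (x i (t + 1) - x i t))"
    unfolding dual_input_def by (rule norm_triangle_ineq)
  ultimately have "norm u \<le> input_bound"
    unfolding input_bound_def by linarith
  then have u: "(norm u)\<^sup>2 \<le> input_bound\<^sup>2"
    by (intro power_mono) auto
  have "q i (t + 1) = pos_part (q i t + c *\<^sub>R u)"
    unfolding q_step[OF i t] b_def[symmetric] c_def[symmetric] u_def by (simp add: algebra_simps)
  then have "(norm (q i (t + 1)))\<^sup>2 \<le> (norm (q i t + c *\<^sub>R u))\<^sup>2"
    using norm_pos_part_le by (simp add: power_mono)
  also have "\<dots> = (norm (q i t))\<^sup>2 + 2 * c * inner (q i t) u + c\<^sup>2 * (norm u)\<^sup>2"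
    using dot_norm[of "q i t" "c *\<^sub>R u"] by (simp add: power_mult_distrib)
  also have "\<dots> \<le> (norm (q i t))\<^sup>2 + 2 * c * inner (q i t) u + c\<^sup>2 * input_bound\<^sup>2"
    using u by (intro add_left_mono mult_left_mono) auto
  finally have "((norm (q i (t + 1)))\<^sup>2 - (norm (q i t))\<^sup>2) / (2 * c)
      \<le> (2 * c * inner (q i t) u + c\<^sup>2 * input_bound\<^sup>2) / (2 * c)"
    using bc by (intro divide_right_mono) auto
  also have "\<dots> = inner (q i t) u + c * input_bound\<^sup>2 / 2"
    using bc by (simp add: field_simps power2_eq_square)
  also have "inner (q i t) u = inner (q i t) (dual_input i t) - b * (norm (q i t))\<^sup>2"
    by (simp add: u_def inner_diff_right dot_square_norm)
  finally show ?thesis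
    by (simp add: b_def c_def)
qed

text \<open>The variational inequality at \<open>y\<close> combined with the three-point identity
  for squared distances. The squared residual is kept because it later pays for the movement and the
  spread.\<close>

lemma projection_step:
  assumes i: "i \<in> {1..n}" and t: "1 \<le> t" and y: "y \<in> X"
  shows "inner (direction i t) (x i (t + 1) - y) + (norm (residual i t))\<^sup>2 / (2 * \<alpha> (t + 1))
    \<le> ((norm (mixed i t - y))\<^sup>2 - (norm (x i (t + 1) - y))\<^sup>2) / (2 * \<alpha> (t + 1))"
proof -
  define a where "a = \<alpha> (t + 1)"
  have a: "0 < a" using \<alpha>_pos[of "t + 1"] by (simp add: a_def)
  let ?z = "mixed i t" and ?x = "x i (t + 1)" and ?d = "direction i t"
  have "inner (?z - a *\<^sub>R ?d - ?x) (y - ?x) \<le> 0"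
    using inner_proj_le_zero[OF X_compact X_convex y, of "?z - a *\<^sub>R ?d"] x_step[OF i t]
    by (simp add: a_def)
  then have "2 * a * inner ?d (?x - y) \<le> - 2 * inner (?z - ?x) (y - ?x)"
    by (simp add: inner_diff_left inner_diff_right algebra_simps)
  also have "\<dots> = (norm (?z - y))\<^sup>2 - (norm (?x - y))\<^sup>2 - (norm (residual i t))\<^sup>2"
    by (simp add: residual_def power2_norm_eq_inner inner_diff_left inner_diff_right inner_commute algebra_simps)
  finally have "(2 * a * inner ?d (?x - y) + (norm (residual i t))\<^sup>2) / (2 * a)
      \<le> ((norm (?z - y))\<^sup>2 - (norm (?x - y))\<^sup>2) / (2 * a)"
    using a by (intro divide_right_mono) auto
  then show ?thesis
    using a by (simp add: add_divide_distrib a_def)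
qed

lemma agent_step:
  assumes i: "i \<in> {1..n}" and t: "1 \<le> t" and y: "y \<in> X"
    and feasible: "\<And>k. k \<in> {1..ms i} \<Longrightarrow> coord (g i t y) k \<le> 0"
  shows "f i t (x i t) - f i t y
      + ((norm (q i (t + 1)))\<^sup>2 - (norm (q i t))\<^sup>2) / (2 * \<gamma> (t + 1)) + \<beta> (t + 1) * (norm (q i t))\<^sup>2
      + (norm (residual i t))\<^sup>2 / (2 * \<alpha> (t + 1))
    \<le> F2 * norm (x i (t + 1) - x i t)
      + ((norm (mixed i t - y))\<^sup>2 - (norm (x i (t + 1) - y))\<^sup>2) / (2 * \<alpha> (t + 1))
      + \<gamma> (t + 1) * input_bound\<^sup>2 / 2"
proof -
  let ?x = "x i t" and ?x' = "x i (t + 1)"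
  let ?M = "mat_vec (ms i) (dg_pos g dg i t ?x) (q i t)"
  have xs: "?x \<in> X" "?x' \<in> X"
    using x_in_X i t by auto
  have M: "inner (q i t) (slope i t ?x v) = inner ?M v" for v
    by (simp add: inner_mat_vec slope_def)
  \<comment> \<open>The projection inequality speaks about the next iterate, the subgradient
    inequality about the current one; passing between them costs F2 times the movement.\<close>
  have "inner (df i t ?x) (?x - ?x') \<le> norm (df i t ?x) * norm (?x - ?x')"
    by (rule norm_cauchy_schwarz)
  also have "\<dots> \<le> F2 * norm (?x' - ?x)"
    using norm_df_le[OF i t xs(1)] by (simp add: norm_minus_commute mult_right_mono)
  finally have loss: "f i t ?x - f i t y \<le> F2 * norm (?x' - ?x) + inner (df i t ?x) (?x' - y)"
    using loss_subgradient[OF i t xs(1) y] by (simp add: inner_diff_right)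
  \<comment> \<open>The linearisation at the current iterate, evaluated at a feasible
    \<open>y\<close>, lies below the positive part of g at \<open>y\<close>, which is zero;
    nonnegativity of q preserves the sign.\<close>
  have "inner (q i t) (violation i t + slope i t ?x (y - ?x)) \<le> inner (q i t) 0"
  proof (rule inner_fsvec_mono)
    fix k
    have "coord (pos_part (g i t y)) k = 0"
      using feasible[of k] g_Rn[OF i t y] by (cases "k \<in> {1..ms i}") (auto simp: Rn_def)
    then show "coord (violation i t + slope i t ?x (y - ?x)) k \<le> coord 0 k"
      using slope_subgradient[OF i t xs(1) y, of k] by (simp add: violation_def)
  qed (use q_nonneg[OF i t] in auto)
  then have "inner (q i t) (violation i t) + inner ?M (y - ?x) \<le> 0"
    by (simp add: inner_add_right M)
  then have dual: "inner (q i t) (dual_input i t) \<le> inner ?M (?x' - y)"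
    by (simp add: dual_input_def inner_add_right M inner_diff_right)
  have "inner (direction i t) (?x' - y) = inner (df i t ?x) (?x' - y) + inner ?M (?x' - y)"
    by (simp add: direction_def inner_add_left)
  with loss dual dual_drift[OF i t] projection_step[OF i t y] show ?thesis
    by linarith
qed

section \<open>Summation over agents and time, and network regret\<close>

definition dual_energy :: "nat \<Rightarrow> real"
  where "dual_energy t = (\<Sum>i\<in>{1..n}. (norm (q i t))\<^sup>2)"

definition residual_energy :: "nat \<Rightarrow> real"
  where "residual_energy t = (\<Sum>i\<in>{1..n}. (norm (residual i t))\<^sup>2)"

lemma dual_energy_nonneg: "0 \<le> dual_energy t"
  and residual_energy_nonneg: "0 \<le> residual_energy t"
  by (simp_all add: dual_energy_def residual_energy_def sum_nonneg)

lemma network_step: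
  assumes t: "1 \<le> t" and y: "y \<in> X"
    and feasible: "\<And>i k. i \<in> {1..n} \<Longrightarrow> k \<in> {1..ms i} \<Longrightarrow> coord (g i t y) k \<le> 0"
  defines "V \<equiv> \<lambda>t. \<Sum>i\<in>{1..n}. (norm (x i t - y))\<^sup>2"
  shows "(\<Sum>i\<in>{1..n}. f i t (x i t) - f i t y)
      + (dual_energy (t + 1) - dual_energy t) / (2 * \<gamma> (t + 1)) + \<beta> (t + 1) * dual_energy t
      + residual_energy t / (2 * \<alpha> (t + 1))
    \<le> F2 * (total_residual t + n * spread t) + (V t - V (t + 1)) / (2 * \<alpha> (t + 1))
      + n * (\<gamma> (t + 1) * input_bound\<^sup>2 / 2)"
proof -
  have a: "0 < \<alpha> (t + 1)" using \<alpha>_pos[of "t + 1"] by simp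
  have "(\<Sum>i\<in>{1..n}. f i t (x i t) - f i t y)
      + (dual_energy (t + 1) - dual_energy t) / (2 * \<gamma> (t + 1)) + \<beta> (t + 1) * dual_energy t
      + residual_energy t / (2 * \<alpha> (t + 1))
    = (\<Sum>i\<in>{1..n}. f i t (x i t) - f i t y
      + ((norm (q i (t + 1)))\<^sup>2 - (norm (q i t))\<^sup>2) / (2 * \<gamma> (t + 1)) + \<beta> (t + 1) * (norm (q i t))\<^sup>2
      + (norm (residual i t))\<^sup>2 / (2 * \<alpha> (t + 1)))"
    by (simp only: dual_energy_def residual_energy_def sum.distrib sum_divide_distrib sum_distrib_left
        sum_subtractf diff_divide_distrib)
  also have "\<dots> \<le> (\<Sum>i\<in>{1..n}. F2 * norm (x i (t + 1) - x i t)
      + ((norm (mixed i t - y))\<^sup>2 - (norm (x i (t + 1) - y))\<^sup>2) / (2 * \<alpha> (t + 1))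
      + \<gamma> (t + 1) * input_bound\<^sup>2 / 2)"
    using feasible by (intro sum_mono agent_step t y) auto
  also have "\<dots> = F2 * (\<Sum>i\<in>{1..n}. norm (x i (t + 1) - x i t))
      + ((\<Sum>i\<in>{1..n}. (norm (mixed i t - y))\<^sup>2) - V (t + 1)) / (2 * \<alpha> (t + 1))
      + n * (\<gamma> (t + 1) * input_bound\<^sup>2 / 2)"
    by (simp add: V_def sum.distrib sum_divide_distrib sum_distrib_left sum_subtractf diff_divide_distrib)
  also have "\<dots> \<le> F2 * (\<Sum>i\<in>{1..n}. norm (residual i t) + spread t)
      + (V t - V (t + 1)) / (2 * \<alpha> (t + 1)) + n * (\<gamma> (t + 1) * input_bound\<^sup>2 / 2)"
    using a sum_norm_mixed_square_le[OF t, where u = "\<lambda>j. x j t" and y = y] norm_step_le[OF t]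
      \<gamma>_pos[of "Suc t"]
    by (intro add_mono mult_left_mono divide_right_mono diff_mono sum_mono)
      (auto simp: F2_nonneg V_def mixed_def)
  finally show ?thesis
    by (simp add: sum.distrib total_residual_def)
qed

lemma accumulated_step:
  assumes y: "y \<in> X"
    and feasible: "\<And>i t k. i \<in> {1..n} \<Longrightarrow> t \<in> {1..T} \<Longrightarrow> k \<in> {1..ms i} \<Longrightarrow> coord (g i t y) k \<le> 0"
  shows "(\<Sum>t\<in>{1..T}. \<Sum>i\<in>{1..n}. f i t (x i t) - f i t y)
      + dual_energy (T + 1) / (2 * \<gamma> (T + 1)) + (\<Sum>t\<in>{1..T}. \<beta> (t + 1) * dual_energy t) / 2
      + (\<Sum>t\<in>{1..T}. residual_energy t / \<alpha> (t + 1)) / 2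
    \<le> F2 * ((\<Sum>t\<in>{1..T}. total_residual t) + n * (\<Sum>t\<in>{1..T}. spread t))
      + 2 * n * R\<^sup>2 / \<alpha> (T + 1) + n * input_bound\<^sup>2 / 2 * (\<Sum>t\<in>{1..T}. \<gamma> (t + 1))"
proof -
  define V where "V t = (\<Sum>i\<in>{1..n}. (norm (x i t - y))\<^sup>2)" for t
  have V: "0 \<le> V t \<and> V t \<le> n * (2 * R)\<^sup>2" if "1 \<le> t" for t
  proof -
    have "V t \<le> (\<Sum>i\<in>{1..n}. (2 * R)\<^sup>2)"
      unfolding V_def using that y by (intro sum_mono power_mono norm_diff_X_le x_in_X) auto
    then show ?thesis by (simp add: V_def sum_nonneg)
  qed
  \<comment> \<open>The growing weights 1/\<alpha> spoil the telescoping; the excess is paid with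
    the bound (2 R)^2 on every squared distance in \<open>X\<close>.\<close>
  have V_sum: "(\<Sum>t\<in>{1..T}. (1 / \<alpha> (t + 1)) * (V t - V (t + 1))) \<le> (1 / \<alpha> (T + 1)) * (n * (2 * R)\<^sup>2)"
    using V \<alpha>_pos \<alpha>_antimono
    by (intro sum_weighted_decrease_le) (auto simp: frac_le less_imp_le)
  have "(\<Sum>t\<in>{1..T}. (V t - V (t + 1)) / (2 * \<alpha> (t + 1)))
      = (\<Sum>t\<in>{1..T}. (1 / \<alpha> (t + 1)) * (V t - V (t + 1))) / 2"
    by (simp add: sum_divide_distrib mult.commute)
  also have "\<dots> \<le> (1 / \<alpha> (T + 1)) * (n * (2 * R)\<^sup>2) / 2"
    by (rule divide_right_mono[OF V_sum]) simp
  also have "\<dots> = 2 * n * R\<^sup>2 / \<alpha> (T + 1)"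
    by (simp add: power_mult_distrib)
  finally have primal: "(\<Sum>t\<in>{1..T}. (V t - V (t + 1)) / (2 * \<alpha> (t + 1))) \<le> 2 * n * R\<^sup>2 / \<alpha> (T + 1)" .
  have Q1: "dual_energy 1 = 0"
    using iterate_init(2) by (simp add: dual_energy_def)
  \<comment> \<open>Half of the damping is spent on the growth of 1/\<gamma>. The other half stays
    in the conclusion, where the violation bound will use it.\<close>
  have "(\<Sum>t\<in>{1..T}. (1 / \<gamma> (t + 1) - 1 / \<gamma> t) * dual_energy t)
      \<le> (\<Sum>t\<in>{1..T}. \<beta> (t + 1) * dual_energy t)"
    using inverse_\<gamma>_step by (intro sum_mono mult_right_mono dual_energy_nonneg) auto
  then have "1 / \<gamma> (T + 1) * dual_energy (T + 1) - (\<Sum>t\<in>{1..T}. \<beta> (t + 1) * dual_energy t)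
      \<le> (\<Sum>t\<in>{1..T}. (1 / \<gamma> (t + 1)) * (dual_energy (t + 1) - dual_energy t))"
    using sum_weighted_increase[where Q = dual_energy and a = "\<lambda>t. 1 / \<gamma> t" and T = T, OF Q1] by linarith
  also have "\<dots> = 2 * (\<Sum>t\<in>{1..T}. (dual_energy (t + 1) - dual_energy t) / (2 * \<gamma> (t + 1)))"
    unfolding sum_distrib_left
  proof (rule sum.cong)
    show "1 / \<gamma> (t + 1) * d = 2 * (d / (2 * \<gamma> (t + 1)))" for t d by simp
  qed simp
  finally have dual: "dual_energy (T + 1) / (2 * \<gamma> (T + 1)) - (\<Sum>t\<in>{1..T}. \<beta> (t + 1) * dual_energy t) / 2
      \<le> (\<Sum>t\<in>{1..T}. (dual_energy (t + 1) - dual_energy t) / (2 * \<gamma> (t + 1)))"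
    by simp
  have "(\<Sum>t\<in>{1..T}. \<Sum>i\<in>{1..n}. f i t (x i t) - f i t y)
      + (\<Sum>t\<in>{1..T}. (dual_energy (t + 1) - dual_energy t) / (2 * \<gamma> (t + 1)))
      + (\<Sum>t\<in>{1..T}. \<beta> (t + 1) * dual_energy t)
      + (\<Sum>t\<in>{1..T}. residual_energy t / (2 * \<alpha> (t + 1)))
    = (\<Sum>t\<in>{1..T}. (\<Sum>i\<in>{1..n}. f i t (x i t) - f i t y)
      + (dual_energy (t + 1) - dual_energy t) / (2 * \<gamma> (t + 1)) + \<beta> (t + 1) * dual_energy t
      + residual_energy t / (2 * \<alpha> (t + 1)))"
    by (simp only: sum.distrib)
  also have "\<dots> \<le> (\<Sum>t\<in>{1..T}. F2 * (total_residual t + n * spread t)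
      + (V t - V (t + 1)) / (2 * \<alpha> (t + 1)) + n * (\<gamma> (t + 1) * input_bound\<^sup>2 / 2))"
    unfolding V_def using feasible by (intro sum_mono network_step y) auto
  also have "\<dots> = F2 * ((\<Sum>t\<in>{1..T}. total_residual t) + n * (\<Sum>t\<in>{1..T}. spread t))
      + (\<Sum>t\<in>{1..T}. (V t - V (t + 1)) / (2 * \<alpha> (t + 1)))
      + n * input_bound\<^sup>2 / 2 * (\<Sum>t\<in>{1..T}. \<gamma> (t + 1))"
  proof -
    have "(\<Sum>t\<in>{1..T}. n * (\<gamma> (t + 1) * input_bound\<^sup>2 / 2))
        = n * input_bound\<^sup>2 / 2 * (\<Sum>t\<in>{1..T}. \<gamma> (t + 1))"
      unfolding sum_distrib_left by (intro sum.cong) auto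
    then show ?thesis
      by (simp only: sum.distrib distrib_left sum_distrib_left)
  qed
  also have "(\<Sum>t\<in>{1..T}. residual_energy t / (2 * \<alpha> (t + 1)))
      = (\<Sum>t\<in>{1..T}. residual_energy t / \<alpha> (t + 1)) / 2"
    by (simp add: sum_divide_distrib mult.commute)
  finally show ?thesis
    using primal dual by linarith
qed

text \<open>Together with \<open>spread_rate\<close> this is the bound of
  \<open>sum_spread_le\<close> for c = 2 R, divided by the contraction gap.\<close>

definition spread_offset :: real
  where "spread_offset = 2 * n * B * R / contraction_gap"

definition spread_rate :: real
  where "spread_rate = 2 * n * B / contraction_gap"

text \<open>The total cost of one unit of residual: F2 for moving the agent itself, and
  \<open>spread_rate\<close> for each of the two charges n F2 on the spread.\<close>

definition residual_price :: real
  where "residual_price = F2 + 2 * n * F2 * spread_rate"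

lemma spread_offset_nonneg: "0 \<le> spread_offset"
  and residual_price_nonneg: "0 \<le> residual_price"
  using contraction_gap_pos R_pos F2_nonneg
  by (simp_all add: spread_offset_def spread_rate_def residual_price_def)

lemma sum_spread_le_residual:
  "(\<Sum>t\<in>{1..T}. spread t) \<le> spread_offset + spread_rate * (\<Sum>t\<in>{1..T}. total_residual t)"
proof -
  have "contraction_gap * (\<Sum>t\<in>{1..T}. spread t)
      \<le> n * B * (2 * R) + 2 * (n * B) * (\<Sum>t\<in>{1..T}. total_residual t)"
    using sum_spread_le[of "2 * R" T] spread_le_diameter R_pos by simp
  then have "(\<Sum>t\<in>{1..T}. spread t)
      \<le> (n * B * (2 * R) + 2 * (n * B) * (\<Sum>t\<in>{1..T}. total_residual t)) / contraction_gap"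
    using contraction_gap_pos by (simp add: pos_le_divide_eq mult.commute)
  then show ?thesis
    by (simp add: spread_offset_def spread_rate_def add_divide_distrib mult_ac)
qed

text \<open>AM-GM weighted so that the squares appear with the factor 1/\<alpha> they have in
  \<open>accumulated_step\<close>. The regret uses h = 1; the violation bound needs h growing with
  T.\<close>

lemma weighted_residual_le:
  fixes c h :: real
  assumes c: "0 \<le> c" and h: "0 < h"
  shows "c * (\<Sum>t\<in>{1..T}. total_residual t)
    \<le> (\<Sum>t\<in>{1..T}. residual_energy t / \<alpha> (t + 1)) / (4 * h) + n * c\<^sup>2 * h * (\<Sum>t\<in>{1..T}. \<alpha> (t + 1))"
proof -
  have "c * total_residual t \<le> residual_energy t / \<alpha> (t + 1) / (4 * h) + n * c\<^sup>2 * h * \<alpha> (t + 1)" for t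
  proof -
    define a where "a = \<alpha> (t + 1) * h"
    have a: "0 < a" using \<alpha>_pos[of "t + 1"] h by (simp add: a_def)
    have "c * v \<le> v\<^sup>2 / (4 * a) + c\<^sup>2 * a" for v
    proof -
      have "0 \<le> (v - 2 * a * c)\<^sup>2 / (4 * a)"
        using a by simp
      also have "\<dots> = v\<^sup>2 / (4 * a) + c\<^sup>2 * a - c * v"
        using a by (simp add: field_simps power2_eq_square)
      finally show ?thesis by simp
    qed
    then have "c * total_residual t \<le> (\<Sum>i\<in>{1..n}. (norm (residual i t))\<^sup>2 / (4 * a) + c\<^sup>2 * a)"
      unfolding total_residual_def sum_distrib_left by (intro sum_mono)
    then show ?thesis
      by (simp add: sum.distrib sum_divide_distrib residual_energy_def a_def mult_ac)
  qed
  then have "c * (\<Sum>t\<in>{1..T}. total_residual t)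
      \<le> (\<Sum>t\<in>{1..T}. residual_energy t / \<alpha> (t + 1) / (4 * h) + n * c\<^sup>2 * h * \<alpha> (t + 1))"
    unfolding sum_distrib_left by (intro sum_mono)
  then show ?thesis
    by (simp only: sum.distrib sum_distrib_left sum_divide_distrib)
qed

definition regret_bound :: "nat \<Rightarrow> real"
  where "regret_bound T = 2 * n * F2 * spread_offset + n * residual_price\<^sup>2 * (\<Sum>t\<in>{1..T}. \<alpha> (t + 1))
    + 2 * n * R\<^sup>2 / \<alpha> (T + 1) + n * input_bound\<^sup>2 / 2 * (\<Sum>t\<in>{1..T}. \<gamma> (t + 1))"

text \<open>The spread term on the left prepays the comparison of agents in
  \<open>net_reg_le\<close>. Of the available half of the residual energy, one quarter absorbs the
  residuals and one quarter is saved for the violation.\<close>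

lemma regret_energy_bound:
  assumes y: "y \<in> X"
    and feasible: "\<And>i t k. i \<in> {1..n} \<Longrightarrow> t \<in> {1..T} \<Longrightarrow> k \<in> {1..ms i} \<Longrightarrow> coord (g i t y) k \<le> 0"
  shows "(\<Sum>t\<in>{1..T}. \<Sum>i\<in>{1..n}. f i t (x i t) - f i t y) + n * F2 * (\<Sum>t\<in>{1..T}. spread t)
      + dual_energy (T + 1) / (2 * \<gamma> (T + 1)) + (\<Sum>t\<in>{1..T}. \<beta> (t + 1) * dual_energy t) / 2
      + (\<Sum>t\<in>{1..T}. residual_energy t / \<alpha> (t + 1)) / 4
    \<le> regret_bound T"
proof -
  let ?S = "\<Sum>t\<in>{1..T}. total_residual t" and ?D = "\<Sum>t\<in>{1..T}. spread t"
  have "2 * n * F2 * ?D \<le> 2 * n * F2 * (spread_offset + spread_rate * ?S)"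
    using F2_nonneg sum_spread_le_residual by (intro mult_left_mono) auto
  then have "F2 * (?S + n * ?D) + n * F2 * ?D \<le> 2 * n * F2 * spread_offset + residual_price * ?S"
    by (simp add: residual_price_def algebra_simps)
  moreover have "residual_price * ?S \<le> (\<Sum>t\<in>{1..T}. residual_energy t / \<alpha> (t + 1)) / 4
      + n * residual_price\<^sup>2 * (\<Sum>t\<in>{1..T}. \<alpha> (t + 1))"
    using weighted_residual_le[OF residual_price_nonneg, of 1 T] by simp
  ultimately show ?thesis
    using accumulated_step[where T = T, OF y feasible] unfolding regret_bound_def by linarith
qed

lemma loss_consensus:
  assumes i: "i \<in> {1..n}" and j: "j \<in> {1..n}" and t: "1 \<le> t"
  shows "f j t (x i t) \<le> f j t (x j t) + F2 * spread t"
proof -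
  have "f j t (x i t) - f j t (x j t) \<le> inner (df j t (x i t)) (x i t - x j t)"
    using i j t by (intro loss_subgradient x_in_X)
  also have "\<dots> \<le> norm (df j t (x i t)) * norm (x i t - x j t)"
    by (rule norm_cauchy_schwarz)
  also have "\<dots> \<le> F2 * spread t"
    using i j t by (intro mult_mono norm_df_le x_in_X norm_diff_le_spread F2_nonneg norm_ge_zero)
  finally show ?thesis by simp
qed

text \<open>The network regret evaluates every loss at every agent's point, while the one-step
  inequality only sees an agent's loss at its own point. Each of the n^2 pairs costs F2 times the
  spread, and the average over agents divides this by n.\<close>

lemma net_reg_le:
  "n * net_reg n f x (\<lambda>_. y) T
    \<le> (\<Sum>t\<in>{1..T}. \<Sum>i\<in>{1..n}. f i t (x i t) - f i t y) + n * F2 * (\<Sum>t\<in>{1..T}. spread t)"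
proof -
  have n: "0 < real n" using n_pos by simp
  let ?L = "\<lambda>t. \<Sum>j\<in>{1..n}. f j t (x j t)"
  have "(\<Sum>i\<in>{1..n}. \<Sum>t\<in>{1..T}. \<Sum>j\<in>{1..n}. f j t (x i t))
      \<le> (\<Sum>i\<in>{1..n}. \<Sum>t\<in>{1..T}. \<Sum>j\<in>{1..n}. f j t (x j t) + F2 * spread t)"
    by (intro sum_mono loss_consensus) auto
  also have "\<dots> = n * ((\<Sum>t\<in>{1..T}. ?L t) + n * F2 * (\<Sum>t\<in>{1..T}. spread t))"
    by (simp add: sum.distrib sum_distrib_left mult_ac)
  finally have "(1 / n) * (\<Sum>i\<in>{1..n}. \<Sum>t\<in>{1..T}. \<Sum>j\<in>{1..n}. f j t (x i t))
      \<le> (\<Sum>t\<in>{1..T}. ?L t) + n * F2 * (\<Sum>t\<in>{1..T}. spread t)"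
    using n by (simp add: pos_divide_le_eq mult.commute)
  moreover have "n * net_reg n f x (\<lambda>_. y) T
      = (1 / n) * (\<Sum>i\<in>{1..n}. \<Sum>t\<in>{1..T}. \<Sum>j\<in>{1..n}. f j t (x i t))
        - (\<Sum>t\<in>{1..T}. \<Sum>j\<in>{1..n}. f j t y)"
    using n by (simp add: net_reg_def global_loss_def right_diff_distrib flip: sum_divide_distrib)
  ultimately show ?thesis
    by (simp add: sum_subtractf)
qed

lemma static_feasibleD:
  assumes "y \<in> static_feasible n ms X g T"
  shows "y \<in> X"
    and "\<And>i t k. i \<in> {1..n} \<Longrightarrow> t \<in> {1..T} \<Longrightarrow> k \<in> {1..ms i} \<Longrightarrow> coord (g i t y) k \<le> 0"
  using assms col_le_zeroD[where v = "\<lambda>i. g i t y" for t]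
  unfolding static_feasible_def global_constr_def by blast+

theorem net_regret_le:
  assumes y: "y \<in> static_feasible n ms X g T"
  shows "n * net_reg n f x (\<lambda>_. y) T \<le> regret_bound T"
proof -
  have "0 \<le> dual_energy (T + 1) / (2 * \<gamma> (T + 1))"
    using dual_energy_nonneg \<gamma>_pos[of "T + 1"] by simp
  moreover have "0 \<le> (\<Sum>t\<in>{1..T}. \<beta> (t + 1) * dual_energy t)"
    using dual_energy_nonneg \<beta>_pos by (intro sum_nonneg mult_nonneg_nonneg) (auto simp: less_imp_le)
  moreover have "0 \<le> (\<Sum>t\<in>{1..T}. residual_energy t / \<alpha> (t + 1))"
    using residual_energy_nonneg \<alpha>_pos by (intro sum_nonneg divide_nonneg_nonneg) (auto simp: less_imp_le)
  ultimately show ?thesis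
    using net_reg_le[of y T] regret_energy_bound[where T = T, OF static_feasibleD[OF y]] by linarith
qed

text \<open>The loss difference to any feasible point may be negative, but not below - n F1 T;
  moving it to the right leaves a bound on the energies alone.\<close>

lemma energy_bound:
  assumes "static_feasible n ms X g T \<noteq> {}"
  shows "dual_energy (T + 1) / (2 * \<gamma> (T + 1)) + (\<Sum>t\<in>{1..T}. \<beta> (t + 1) * dual_energy t) / 2
      + (\<Sum>t\<in>{1..T}. residual_energy t / \<alpha> (t + 1)) / 4
    \<le> regret_bound T + n * F1 * T"
proof -
  obtain y where y: "y \<in> static_feasible n ms X g T"
    using assms by blast
  have "(\<Sum>t\<in>{1..T}. \<Sum>i\<in>{1..n}. - F1) \<le> (\<Sum>t\<in>{1..T}. \<Sum>i\<in>{1..n}. f i t (x i t) - f i t y)"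
  proof (intro sum_mono)
    fix t i assume "t \<in> {1..T}" "i \<in> {1..n}"
    then show "- F1 \<le> f i t (x i t) - f i t y"
      using loss_diff_le[of i t "x i t" y] x_in_X[of i t] static_feasibleD(1)[OF y] by auto
  qed
  moreover have "0 \<le> n * F2 * (\<Sum>t\<in>{1..T}. spread t)"
    by (intro mult_nonneg_nonneg sum_nonneg F2_nonneg spread_nonneg) auto
  ultimately show ?thesis
    using regret_energy_bound[where T = T, OF static_feasibleD[OF y]] by (simp add: algebra_simps)
qed

section \<open>Cumulative constraint violation\<close>

definition dual_mass :: "nat \<Rightarrow> nat \<Rightarrow> real"
  where "dual_mass i t = (\<Sum>k\<in>{1..ms i}. coord (q i t) k)"

definition total_violation :: "nat \<Rightarrow> real"
  where "total_violation t = (\<Sum>i\<in>{1..n}. \<Sum>k\<in>{1..ms i}. coord (violation i t) k)"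

lemma dual_mass_nonneg: "i \<in> {1..n} \<Longrightarrow> 1 \<le> t \<Longrightarrow> 0 \<le> dual_mass i t"
  unfolding dual_mass_def by (intro sum_nonneg q_nonneg)

definition root_dim :: real
  where "root_dim = sqrt (real (\<Sum>i\<in>{1..n}. ms i))"

lemma root_dim_nonneg: "0 \<le> root_dim"
  by (simp add: root_dim_def sum_nonneg)

lemma sum_abs_coord_le_total:
  assumes "i \<in> {1..n}"
  shows "(\<Sum>k\<in>{1..ms i}. \<bar>coord v k\<bar>) \<le> root_dim * norm v"
proof -
  have "ms i \<le> (\<Sum>i\<in>{1..n}. ms i)"
    using assms by (intro member_le_sum) auto
  then have "sqrt (ms i) * norm v \<le> root_dim * norm v"
    unfolding root_dim_def by (intro mult_right_mono real_sqrt_le_mono of_nat_mono) auto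
  then show ?thesis
    using sum_abs_coord_le[of "{1..ms i}" v] by simp
qed

lemma dual_mass_le: "i \<in> {1..n} \<Longrightarrow> dual_mass i t \<le> root_dim * norm (q i t)"
  unfolding dual_mass_def
  by (rule order_trans[OF sum_mono sum_abs_coord_le_total]) auto

text \<open>Dropping the positive part in the dual update gives a coordinatewise lower bound for the
  new dual, which is solved for the violation. The sum of coordinates is used since, unlike the
  norm, it is linear in q; by nonnegativity of q it is the l1 norm.\<close>

lemma agent_violation_le:
  assumes i: "i \<in> {1..n}" and t: "1 \<le> t"
  shows "(\<Sum>k\<in>{1..ms i}. coord (violation i t) k)
    \<le> (1 / \<gamma> (t + 1)) * (dual_mass i (t + 1) - dual_mass i t) + \<beta> (t + 1) * dual_mass i t
      + root_dim * (F2 * norm (x i (t + 1) - x i t))"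
proof -
  define b c where "b = \<beta> (t + 1)" and "c = \<gamma> (t + 1)"
  have c: "0 < c" using \<gamma>_pos[of "t + 1"] by (simp add: c_def)
  let ?s = "slope i t (x i t) (x i (t + 1) - x i t)"
  have "coord (violation i t) k
      \<le> (1 / c) * (coord (q i (t + 1)) k - coord (q i t) k) + b * coord (q i t) k + \<bar>coord ?s k\<bar>" for k
  proof -
    have "(1 - b * c) * coord (q i t) k + c * (coord (violation i t) k + coord ?s k) \<le> coord (q i (t + 1)) k"
      unfolding q_step[OF i t] b_def c_def dual_input_def by simp
    then have "coord (violation i t) k + coord ?s k
        \<le> (coord (q i (t + 1)) k - (1 - b * c) * coord (q i t) k) / c"
      using c by (simp add: pos_le_divide_eq algebra_simps)
    also have "\<dots> = (1 / c) * (coord (q i (t + 1)) k - coord (q i t) k) + b * coord (q i t) k"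
      using c by (simp add: field_simps)
    finally show ?thesis by linarith
  qed
  then have "(\<Sum>k\<in>{1..ms i}. coord (violation i t) k)
      \<le> (\<Sum>k\<in>{1..ms i}. (1 / c) * (coord (q i (t + 1)) k - coord (q i t) k) + b * coord (q i t) k + \<bar>coord ?s k\<bar>)"
    by (intro sum_mono)
  also have "\<dots> = (1 / c) * (dual_mass i (t + 1) - dual_mass i t) + b * dual_mass i t
      + (\<Sum>k\<in>{1..ms i}. \<bar>coord ?s k\<bar>)"
    by (simp only: sum.distrib sum_distrib_left[symmetric] sum_subtractf dual_mass_def)
  also have "(\<Sum>k\<in>{1..ms i}. \<bar>coord ?s k\<bar>) \<le> root_dim * norm ?s"
    by (rule sum_abs_coord_le_total[OF i])
  also have "\<dots> \<le> root_dim * (F2 * norm (x i (t + 1) - x i t))"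
    by (intro mult_left_mono norm_slope_le i t x_in_X root_dim_nonneg)
  finally show ?thesis
    by (simp add: b_def c_def)
qed

lemma agent_cumulative_violation_le:
  assumes i: "i \<in> {1..n}"
  shows "(\<Sum>t\<in>{1..T}. \<Sum>k\<in>{1..ms i}. coord (violation i t) k)
    \<le> root_dim * ((1 / \<gamma> (T + 1)) * norm (q i (T + 1))
      + (\<Sum>t\<in>{1..T}. \<beta> (t + 1) * norm (q i t)) + F2 * (\<Sum>t\<in>{1..T}. norm (residual i t) + spread t))"
proof -
  \<comment> \<open>In the summation by parts the increments of 1/\<gamma> enter with a minus sign,
    so their nonnegativity lets them be discarded and only the final dual remains.\<close>
  have \<gamma>_mono: "0 \<le> (1 / \<gamma> (t + 1) - 1 / \<gamma> t) * dual_mass i t" if "t \<in> {1..T}" for t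
    using that \<gamma>_pos[of t] \<gamma>_pos[of "t + 1"] \<gamma>_antimono[of t]
    by (intro mult_nonneg_nonneg dual_mass_nonneg i) (auto simp: frac_le)
  have "0 \<le> (\<Sum>t\<in>{1..T}. (1 / \<gamma> (t + 1) - 1 / \<gamma> t) * dual_mass i t)"
    by (intro sum_nonneg \<gamma>_mono)
  moreover have "dual_mass i 1 = 0"
    using iterate_init(2)[OF i] by (simp add: dual_mass_def)
  ultimately have "(\<Sum>t\<in>{1..T}. (1 / \<gamma> (t + 1)) * (dual_mass i (t + 1) - dual_mass i t))
      \<le> (1 / \<gamma> (T + 1)) * dual_mass i (T + 1)"
    using sum_weighted_increase[where Q = "dual_mass i" and a = "\<lambda>t. 1 / \<gamma> t" and T = T]
    by linarith
  also have "\<dots> \<le> (1 / \<gamma> (T + 1)) * (root_dim * norm (q i (T + 1)))"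
    using \<gamma>_pos[of "T + 1"] by (intro mult_left_mono dual_mass_le i) auto
  finally have 1: "(\<Sum>t\<in>{1..T}. (1 / \<gamma> (t + 1)) * (dual_mass i (t + 1) - dual_mass i t))
      \<le> root_dim * ((1 / \<gamma> (T + 1)) * norm (q i (T + 1)))"
    by (simp only: mult.left_commute)
  have "(\<Sum>t\<in>{1..T}. \<beta> (t + 1) * dual_mass i t) \<le> (\<Sum>t\<in>{1..T}. \<beta> (t + 1) * (root_dim * norm (q i t)))"
    using \<beta>_pos by (intro sum_mono mult_left_mono dual_mass_le i) (auto simp: less_imp_le)
  then have 2: "(\<Sum>t\<in>{1..T}. \<beta> (t + 1) * dual_mass i t) \<le> root_dim * (\<Sum>t\<in>{1..T}. \<beta> (t + 1) * norm (q i t))"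
    by (simp only: mult.left_commute sum_distrib_left)
  have "(\<Sum>t\<in>{1..T}. root_dim * (F2 * norm (x i (t + 1) - x i t)))
      \<le> (\<Sum>t\<in>{1..T}. root_dim * (F2 * (norm (residual i t) + spread t)))"
    using norm_step_le[OF _ i] by (intro sum_mono mult_left_mono F2_nonneg root_dim_nonneg) auto
  then have 3: "(\<Sum>t\<in>{1..T}. root_dim * (F2 * norm (x i (t + 1) - x i t)))
      \<le> root_dim * (F2 * (\<Sum>t\<in>{1..T}. norm (residual i t) + spread t))"
    by (simp only: sum_distrib_left)
  have "(\<Sum>t\<in>{1..T}. \<Sum>k\<in>{1..ms i}. coord (violation i t) k)
      \<le> (\<Sum>t\<in>{1..T}. (1 / \<gamma> (t + 1)) * (dual_mass i (t + 1) - dual_mass i t) + \<beta> (t + 1) * dual_mass i t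
      + root_dim * (F2 * norm (x i (t + 1) - x i t)))"
    by (intro sum_mono agent_violation_le i) auto
  also have "\<dots> \<le> root_dim * ((1 / \<gamma> (T + 1)) * norm (q i (T + 1)))
      + root_dim * (\<Sum>t\<in>{1..T}. \<beta> (t + 1) * norm (q i t))
      + root_dim * (F2 * (\<Sum>t\<in>{1..T}. norm (residual i t) + spread t))"
    unfolding sum.distrib by (intro add_mono 1 2 3[unfolded sum.distrib])
  finally show ?thesis
    by (simp only: distrib_left)
qed

lemma weighted_sum_norm_q_le:
  fixes c h :: real
  assumes "0 \<le> c" and "0 < h"
  shows "(\<Sum>i\<in>{1..n}. c * norm (q i t)) \<le> n * h * c / 2 + c * dual_energy t / 2 / h"
proof -
  have "(\<Sum>i\<in>{1..n}. c * norm (q i t)) \<le> (\<Sum>i\<in>{1..n}. c * h / 2 + c * (norm (q i t))\<^sup>2 / (2 * h))"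
    by (intro sum_mono mult_le_weighted_square assms)
  also have "\<dots> = n * h * c / 2 + c * dual_energy t / 2 / h"
    by (simp add: sum.distrib dual_energy_def sum_distrib_left sum_divide_distrib mult_ac)
  finally show ?thesis .
qed

text \<open>AM-GM with the same \<open>h\<close> for every dual norm: the squares reassemble to the
  dual part of \<open>energy_bound\<close> divided by \<open>h\<close>, and the constant parts to
  \<open>h\<close> times the total weight 1/\<gamma>(T+1) + sum of \<beta>.\<close>

lemma sum_total_violation_le:
  fixes h :: real
  assumes h: "0 < h"
  shows "(\<Sum>t\<in>{1..T}. total_violation t)
    \<le> root_dim * (n * h / 2 * (1 / \<gamma> (T + 1) + (\<Sum>t\<in>{1..T}. \<beta> (t + 1)))
      + (dual_energy (T + 1) / (2 * \<gamma> (T + 1)) + (\<Sum>t\<in>{1..T}. \<beta> (t + 1) * dual_energy t) / 2) / h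
      + F2 * ((\<Sum>t\<in>{1..T}. total_residual t) + n * (\<Sum>t\<in>{1..T}. spread t)))"
proof -
  have "(\<Sum>t\<in>{1..T}. total_violation t) = (\<Sum>i\<in>{1..n}. \<Sum>t\<in>{1..T}. \<Sum>k\<in>{1..ms i}. coord (violation i t) k)"
    unfolding total_violation_def by (rule sum.swap)
  also have "\<dots> \<le> (\<Sum>i\<in>{1..n}. root_dim * ((1 / \<gamma> (T + 1)) * norm (q i (T + 1))
      + (\<Sum>t\<in>{1..T}. \<beta> (t + 1) * norm (q i t)) + F2 * (\<Sum>t\<in>{1..T}. norm (residual i t) + spread t)))"
    by (intro sum_mono agent_cumulative_violation_le)
  also have "\<dots> = root_dim * ((\<Sum>i\<in>{1..n}. (1 / \<gamma> (T + 1)) * norm (q i (T + 1)))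
      + (\<Sum>t\<in>{1..T}. \<Sum>i\<in>{1..n}. \<beta> (t + 1) * norm (q i t))
      + F2 * (\<Sum>t\<in>{1..T}. \<Sum>i\<in>{1..n}. norm (residual i t) + spread t))"
    by (simp only: sum_distrib_left[symmetric] sum.distrib sum.swap[of _ "{1..T}" "{1..n}"])
  also have "\<dots> \<le> root_dim * ((n * h * (1 / \<gamma> (T + 1)) / 2 + (1 / \<gamma> (T + 1)) * dual_energy (T + 1) / 2 / h)
      + (\<Sum>t\<in>{1..T}. n * h * \<beta> (t + 1) / 2 + \<beta> (t + 1) * dual_energy t / 2 / h)
      + F2 * (\<Sum>t\<in>{1..T}. total_residual t + n * spread t))"
    using less_imp_le[OF \<gamma>_pos[of "T + 1"]] less_imp_le[OF \<beta>_pos]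
    by (intro mult_left_mono[OF _ root_dim_nonneg] mult_left_mono[OF _ F2_nonneg] add_mono sum_mono
        weighted_sum_norm_q_le h) (auto simp: total_residual_def sum.distrib)
  also have "\<dots> = root_dim * (n * h / 2 * (1 / \<gamma> (T + 1) + (\<Sum>t\<in>{1..T}. \<beta> (t + 1)))
      + (dual_energy (T + 1) / (2 * \<gamma> (T + 1)) + (\<Sum>t\<in>{1..T}. \<beta> (t + 1) * dual_energy t) / 2) / h
      + F2 * ((\<Sum>t\<in>{1..T}. total_residual t) + n * (\<Sum>t\<in>{1..T}. spread t)))"
    by (simp add: sum.distrib sum_distrib_left[symmetric] sum_divide_distrib[symmetric]
        add_divide_distrib distrib_left mult.commute sum_distrib_right[symmetric])
  finally show ?thesis .
qed

text \<open>Agent i is judged by the constraints of all agents, but the violation of agent j's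
  constraint is known only at agent j's own point. Linearising at agent i's point transfers it at a
  cost proportional to the spread.\<close>

lemma norm_global_violation_le:
  assumes i: "i \<in> {1..n}" and t: "1 \<le> t"
  shows "norm (pos_part (global_constr n ms g t (x i t)))
    \<le> total_violation t + n * root_dim * (F2 * spread t)"
proof -
  have "norm (pos_part (global_constr n ms g t (x i t)))
      \<le> (\<Sum>j\<in>{1..n}. \<Sum>k\<in>{1..ms j}. max (coord (g j t (x i t)) k) 0)"
    unfolding global_constr_def by (rule norm_pos_part_col_le)
  also have "\<dots> \<le> (\<Sum>j\<in>{1..n}. (\<Sum>k\<in>{1..ms j}. coord (violation j t) k) + root_dim * (F2 * spread t))"
  proof (rule sum_mono)
    fix j assume j: "j \<in> {1..n}"
    let ?s = "slope j t (x i t) (x j t - x i t)"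
    have "(\<Sum>k\<in>{1..ms j}. max (coord (g j t (x i t)) k) 0)
        \<le> (\<Sum>k\<in>{1..ms j}. coord (violation j t) k + \<bar>coord ?s k\<bar>)"
    proof (rule sum_mono)
      fix k
      show "max (coord (g j t (x i t)) k) 0 \<le> coord (violation j t) k + \<bar>coord ?s k\<bar>"
        using slope_subgradient[OF j t x_in_X[OF i t] x_in_X[OF j t], of k]
        unfolding violation_def coord_pos_part by linarith
    qed
    also have "\<dots> \<le> (\<Sum>k\<in>{1..ms j}. coord (violation j t) k) + root_dim * norm ?s"
      using sum_abs_coord_le_total[OF j, of ?s] by (simp add: sum.distrib)
    also have "\<dots> \<le> (\<Sum>k\<in>{1..ms j}. coord (violation j t) k) + root_dim * (F2 * spread t)"
    proof (intro add_left_mono mult_left_mono root_dim_nonneg)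
      have "norm ?s \<le> F2 * norm (x j t - x i t)"
        by (rule norm_slope_le[OF j t x_in_X[OF i t]])
      also have "\<dots> \<le> F2 * spread t"
        by (intro mult_left_mono norm_diff_le_spread j i F2_nonneg)
      finally show "norm ?s \<le> F2 * spread t" .
    qed
    finally show "(\<Sum>k\<in>{1..ms j}. max (coord (g j t (x i t)) k) 0)
        \<le> (\<Sum>k\<in>{1..ms j}. coord (violation j t) k) + root_dim * (F2 * spread t)" .
  qed
  finally show ?thesis
    by (simp add: sum.distrib total_violation_def)
qed

text \<open>The spread occurs once from the movement of iterates and once from the transfer between
  agents, which is again the combination priced by \<open>residual_price\<close>. The dual and
  residual parts then add up to the left side of \<open>energy_bound\<close> divided by
  \<open>h\<close>.\<close>

theorem cumulative_violation_le:
  fixes h :: real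
  assumes feasible: "static_feasible n ms X g T \<noteq> {}" and h: "0 < h"
  shows "(\<Sum>i\<in>{1..n}. \<Sum>t\<in>{1..T}. norm (pos_part (global_constr n ms g t (x i t))))
    \<le> n * root_dim * (n * h / 2 * (1 / \<gamma> (T + 1) + (\<Sum>t\<in>{1..T}. \<beta> (t + 1)))
      + (regret_bound T + n * F1 * T) / h
      + 2 * n * F2 * spread_offset + n * residual_price\<^sup>2 * h * (\<Sum>t\<in>{1..T}. \<alpha> (t + 1)))"
proof -
  let ?S = "\<Sum>t\<in>{1..T}. total_residual t" and ?D = "\<Sum>t\<in>{1..T}. spread t"
  let ?A = "n * h / 2 * (1 / \<gamma> (T + 1) + (\<Sum>t\<in>{1..T}. \<beta> (t + 1)))"
  let ?Q = "dual_energy (T + 1) / (2 * \<gamma> (T + 1)) + (\<Sum>t\<in>{1..T}. \<beta> (t + 1) * dual_energy t) / 2"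
  let ?E = "\<Sum>t\<in>{1..T}. residual_energy t / \<alpha> (t + 1)"
  have "(\<Sum>i\<in>{1..n}. \<Sum>t\<in>{1..T}. norm (pos_part (global_constr n ms g t (x i t))))
      \<le> (\<Sum>i\<in>{1..n}. \<Sum>t\<in>{1..T}. total_violation t + n * root_dim * (F2 * spread t))"
    by (intro sum_mono norm_global_violation_le) auto
  also have "\<dots> = n * ((\<Sum>t\<in>{1..T}. total_violation t) + root_dim * (n * F2 * ?D))"
    by (simp add: sum.distrib sum_distrib_left mult_ac)
  also have "\<dots> \<le> n * (root_dim * (?A + ?Q / h + F2 * (?S + n * ?D)) + root_dim * (n * F2 * ?D))"
    using sum_total_violation_le[OF h, of T] by (intro mult_left_mono add_right_mono) auto
  also have "\<dots> = n * root_dim * (?A + ?Q / h + (F2 * ?S + 2 * n * F2 * ?D))"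
    by (simp add: algebra_simps)
  also have "\<dots> \<le> n * root_dim * (?A + (regret_bound T + n * F1 * T) / h
      + 2 * n * F2 * spread_offset + n * residual_price\<^sup>2 * h * (\<Sum>t\<in>{1..T}. \<alpha> (t + 1)))"
  proof -
    have "2 * n * F2 * ?D \<le> 2 * n * F2 * (spread_offset + spread_rate * ?S)"
      using F2_nonneg sum_spread_le_residual by (intro mult_left_mono) auto
    then have "F2 * ?S + 2 * n * F2 * ?D \<le> 2 * n * F2 * spread_offset + residual_price * ?S"
      by (simp add: residual_price_def algebra_simps)
    moreover have "residual_price * ?S \<le> ?E / 4 / h + n * residual_price\<^sup>2 * h * (\<Sum>t\<in>{1..T}. \<alpha> (t + 1))"
      using weighted_residual_le[OF residual_price_nonneg h, of T] by simp
    moreover have "?Q / h + ?E / 4 / h \<le> (regret_bound T + n * F1 * T) / h"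
      using divide_right_mono[OF energy_bound[OF feasible] less_imp_le[OF h]]
      by (simp only: add_divide_distrib)
    ultimately have "?A + ?Q / h + (F2 * ?S + 2 * n * F2 * ?D) \<le> ?A + (regret_bound T + n * F1 * T) / h
        + 2 * n * F2 * spread_offset + n * residual_price\<^sup>2 * h * (\<Sum>t\<in>{1..T}. \<alpha> (t + 1))"
      by linarith
    then show ?thesis
      by (intro mult_left_mono) (auto simp: root_dim_nonneg)
  qed
  finally show ?thesis .
qed

end

section \<open>Power step sizes\<close>

text \<open>For a = \<kappa> this verifies \<open>inverse_\<gamma>_step\<close>. After
  multiplication by (t+1)^a the first power becomes t + 1 and the second is at least t.\<close>

lemma powr_increment_le:
  assumes "1 \<le> t" and "0 < a" and "a < 1"
  shows "real (t + 1) powr (1 - a) - real t powr (1 - a) \<le> 1 / real (t + 1) powr a"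
proof -
  have "real t = real t powr (1 - a) * real t powr a"
    using assms by (simp flip: powr_add)
  also have "\<dots> \<le> real t powr (1 - a) * real (t + 1) powr a"
    using assms by (intro mult_left_mono powr_mono2) auto
  finally have "real (t + 1) - real t powr (1 - a) * real (t + 1) powr a \<le> 1"
    by simp
  moreover have "real (t + 1) = real (t + 1) powr (1 - a) * real (t + 1) powr a"
    by (simp flip: powr_add)
  ultimately have "(real (t + 1) powr (1 - a) - real t powr (1 - a)) * real (t + 1) powr a \<le> 1"
    by (simp add: left_diff_distrib)
  then show ?thesis
    by (simp add: pos_le_divide_eq)
qed

lemma sum_inverse_powr_le_two_mult:
  assumes "1 \<le> T" and "0 < a" and "a < 1"
  shows "(\<Sum>t\<in>{1..T}. 1 / real (t + 1) powr a) \<le> 2 / (1 - a) * real T powr (1 - a)"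
proof -
  have "real (T + 1) powr (1 - a) / (1 - a) \<le> 2 * real T powr (1 - a) / (1 - a)"
    using assms by (intro divide_right_mono Suc_powr_le_two_mult) auto
  then show ?thesis
    using sum_inverse_powr_le[OF assms(2,3), of T] by simp
qed

section \<open>Regret and violation rates\<close>

context primal_dual_iteration
begin

definition regret_const :: "real \<Rightarrow> real"
  where "regret_const \<kappa> = 2 * n * F2 * spread_offset + n * residual_price\<^sup>2 * (2 / (1 - \<kappa>))
    + 4 * n * R\<^sup>2 + n * input_bound\<^sup>2 / \<kappa>"

text \<open>The dimension m is an argument rather than the sum of \<open>ms\<close>, so that outside
  the locale this constant depends on n, w, B, R, F1, F2, \<kappa> and m only and can be fixed
  before the problem data.\<close>

definition violation_const :: "real \<Rightarrow> nat \<Rightarrow> real"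
  where "violation_const \<kappa> m = n * sqrt m * (n + n / (1 - \<kappa>) + regret_const \<kappa> + n * F1
    + 2 * n * F2 * spread_offset + n * residual_price\<^sup>2 * (2 / (1 - \<kappa>)))"

context
  fixes \<kappa> :: real and T :: nat
  assumes \<kappa>: "0 < \<kappa>" "\<kappa> < 1"
    and \<alpha>: "\<alpha> = (\<lambda>t. 1 / real t powr \<kappa>)"
    and \<beta>: "\<beta> = (\<lambda>t. 1 / real t powr \<kappa>)"
    and \<gamma>: "\<gamma> = (\<lambda>t. 1 / real t powr (1 - \<kappa>))"
    and T: "1 \<le> T"
begin

text \<open>The sum of \<alpha> is of order T^(1-\<kappa>); 1/\<alpha>(T+1) and the sum of \<gamma>
  are of order T^\<kappa>. This is the origin of the maximum.\<close>

lemma regret_bound_le: "regret_bound T \<le> regret_const \<kappa> * real T powr max \<kappa> (1 - \<kappa>)"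
proof -
  let ?P = "real T powr max \<kappa> (1 - \<kappa>)"
  have P: "real T powr \<kappa> \<le> ?P" "real T powr (1 - \<kappa>) \<le> ?P" "1 \<le> ?P"
    using T \<kappa> by (auto intro!: powr_mono ge_one_powr_ge_zero)
  have "(\<Sum>t\<in>{1..T}. \<alpha> (t + 1)) \<le> 2 / (1 - \<kappa>) * ?P"
    unfolding \<alpha> using \<kappa>
    by (intro order_trans[OF sum_inverse_powr_le_two_mult[OF T \<kappa>] mult_left_mono[OF P(2)]]) auto
  then have 1: "n * residual_price\<^sup>2 * (\<Sum>t\<in>{1..T}. \<alpha> (t + 1)) \<le> n * residual_price\<^sup>2 * (2 / (1 - \<kappa>) * ?P)"
    by (intro mult_left_mono) auto
  have "1 / \<alpha> (T + 1) \<le> 2 * ?P"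
    using Suc_powr_le_two_mult[OF T, of \<kappa>] \<kappa> P(1) by (simp add: \<alpha>)
  then have 2: "2 * n * R\<^sup>2 * (1 / \<alpha> (T + 1)) \<le> 2 * n * R\<^sup>2 * (2 * ?P)"
    by (intro mult_left_mono) auto
  have "(\<Sum>t\<in>{1..T}. \<gamma> (t + 1)) \<le> 2 / \<kappa> * ?P"
    unfolding \<gamma> using sum_inverse_powr_le_two_mult[OF T, of "1 - \<kappa>"] mult_left_mono[OF P(1), of "2 / \<kappa>"] \<kappa>
    by simp
  then have 3: "n * input_bound\<^sup>2 / 2 * (\<Sum>t\<in>{1..T}. \<gamma> (t + 1)) \<le> n * input_bound\<^sup>2 / 2 * (2 / \<kappa> * ?P)"
    by (intro mult_left_mono) auto
  have 4: "2 * n * F2 * spread_offset * 1 \<le> 2 * n * F2 * spread_offset * ?P"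
    using P(3) F2_nonneg spread_offset_nonneg by (intro mult_left_mono) auto
  have "regret_bound T = 2 * n * F2 * spread_offset * 1 + n * residual_price\<^sup>2 * (\<Sum>t\<in>{1..T}. \<alpha> (t + 1))
      + 2 * n * R\<^sup>2 * (1 / \<alpha> (T + 1)) + n * input_bound\<^sup>2 / 2 * (\<Sum>t\<in>{1..T}. \<gamma> (t + 1))"
    by (simp add: regret_bound_def)
  also have "\<dots> \<le> 2 * n * F2 * spread_offset * ?P + n * residual_price\<^sup>2 * (2 / (1 - \<kappa>) * ?P)
      + 2 * n * R\<^sup>2 * (2 * ?P) + n * input_bound\<^sup>2 / 2 * (2 / \<kappa> * ?P)"
    by (intro add_mono 1 2 3 4)
  also have "\<dots> = regret_const \<kappa> * ?P"
    by (simp add: regret_const_def algebra_simps)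
  finally show ?thesis .
qed

lemma regret_const_nonneg: "0 \<le> regret_const \<kappa>"
  using \<kappa> F2_nonneg spread_offset_nonneg by (simp add: regret_const_def)

lemma net_reg_rate:
  assumes "y \<in> static_feasible n ms X g T"
  shows "net_reg n f x (\<lambda>_. y) T \<le> regret_const \<kappa> / n * real T powr max \<kappa> (1 - \<kappa>)"
  using net_regret_le[OF assms] regret_bound_le n_pos by (simp add: field_simps)

lemma violation_rate:
  assumes "static_feasible n ms X g T \<noteq> {}"
  shows "(\<Sum>i\<in>{1..n}. \<Sum>t\<in>{1..T}. norm (pos_part (global_constr n ms g t (x i t))))
    \<le> violation_const \<kappa> (\<Sum>i\<in>{1..n}. ms i) * real T powr (1 - \<kappa> / 2)"
proof -
  \<comment> \<open>Chosen so that h T^(1-\<kappa>) and T / h are both equal to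
    T^(1-\<kappa>/2).\<close>
  define h where "h = real T powr (\<kappa> / 2)"
  let ?P = "real T powr (1 - \<kappa> / 2)"
  have h: "0 < h" using T by (simp add: h_def)
  have hT: "h * real T powr (1 - \<kappa>) = ?P" and Th: "real T = ?P * h"
    using T by (simp_all add: h_def flip: powr_add)
  have P1: "1 \<le> ?P"
    using T \<kappa> by (intro ge_one_powr_ge_zero) auto
  have S: "(\<Sum>t\<in>{1..T}. 1 / real (t + 1) powr \<kappa>) \<le> 2 / (1 - \<kappa>) * real T powr (1 - \<kappa>)"
    by (rule sum_inverse_powr_le_two_mult[OF T \<kappa>])
  have "1 / \<gamma> (T + 1) + (\<Sum>t\<in>{1..T}. \<beta> (t + 1)) \<le> 2 * real T powr (1 - \<kappa>) + 2 / (1 - \<kappa>) * real T powr (1 - \<kappa>)"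
    using S Suc_powr_le_two_mult[OF T, of "1 - \<kappa>"] \<kappa> by (intro add_mono) (simp_all add: \<beta> \<gamma>)
  then have "n * h / 2 * (1 / \<gamma> (T + 1) + (\<Sum>t\<in>{1..T}. \<beta> (t + 1)))
      \<le> n * h / 2 * (2 * real T powr (1 - \<kappa>) + 2 / (1 - \<kappa>) * real T powr (1 - \<kappa>))"
    using h by (intro mult_left_mono) auto
  also have "\<dots> = (n + n / (1 - \<kappa>)) * (h * real T powr (1 - \<kappa>))"
    using \<kappa> by (simp add: field_simps)
  finally have 1: "n * h / 2 * (1 / \<gamma> (T + 1) + (\<Sum>t\<in>{1..T}. \<beta> (t + 1))) \<le> (n + n / (1 - \<kappa>)) * ?P"
    by (simp only: hT)
  have "n * residual_price\<^sup>2 * h * (\<Sum>t\<in>{1..T}. \<alpha> (t + 1))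
      \<le> n * residual_price\<^sup>2 * h * (2 / (1 - \<kappa>) * real T powr (1 - \<kappa>))"
    using S h by (intro mult_left_mono) (simp_all add: \<alpha>)
  also have "\<dots> = n * residual_price\<^sup>2 * (2 / (1 - \<kappa>)) * (h * real T powr (1 - \<kappa>))"
    by (simp add: mult_ac)
  finally have 2: "n * residual_price\<^sup>2 * h * (\<Sum>t\<in>{1..T}. \<alpha> (t + 1)) \<le> n * residual_price\<^sup>2 * (2 / (1 - \<kappa>)) * ?P"
    by (simp only: hT)
  \<comment> \<open>The crude exponent 1 is harmless here: the energy bound contains the linear term
    n F1 T anyway.\<close>
  have "real T powr max \<kappa> (1 - \<kappa>) \<le> real T powr 1"
    using T \<kappa> by (intro powr_mono) auto
  then have "regret_const \<kappa> * real T powr max \<kappa> (1 - \<kappa>) \<le> regret_const \<kappa> * real T"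
    using regret_const_nonneg T by (intro mult_left_mono) auto
  then have "(regret_bound T + n * F1 * T) / h \<le> (regret_const \<kappa> * real T + n * F1 * T) / h"
    using regret_bound_le h by (intro divide_right_mono add_right_mono) auto
  also have "\<dots> = (regret_const \<kappa> + n * F1) * (real T / h)"
    by (simp add: add_divide_distrib distrib_right)
  also have "real T / h = ?P"
    using Th h by (metis nonzero_mult_div_cancel_right less_irrefl)
  finally have 3: "(regret_bound T + n * F1 * T) / h \<le> (regret_const \<kappa> + n * F1) * ?P" .
  have 4: "2 * n * F2 * spread_offset \<le> 2 * n * F2 * spread_offset * ?P"
    using mult_left_mono[OF P1, of "2 * n * F2 * spread_offset"] F2_nonneg spread_offset_nonneg by simp
  have "(\<Sum>i\<in>{1..n}. \<Sum>t\<in>{1..T}. norm (pos_part (global_constr n ms g t (x i t))))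
    \<le> n * root_dim * (n * h / 2 * (1 / \<gamma> (T + 1) + (\<Sum>t\<in>{1..T}. \<beta> (t + 1)))
      + (regret_bound T + n * F1 * T) / h
      + 2 * n * F2 * spread_offset + n * residual_price\<^sup>2 * h * (\<Sum>t\<in>{1..T}. \<alpha> (t + 1)))"
    by (rule cumulative_violation_le[OF assms h])
  also have "\<dots> \<le> n * root_dim * ((n + n / (1 - \<kappa>)) * ?P + (regret_const \<kappa> + n * F1) * ?P
      + 2 * n * F2 * spread_offset * ?P + n * residual_price\<^sup>2 * (2 / (1 - \<kappa>)) * ?P)"
    by (intro mult_left_mono add_mono 1 2 3 4) (simp_all add: root_dim_nonneg)
  also have "\<dots> = n * root_dim * ((n + n / (1 - \<kappa>) + regret_const \<kappa> + n * F1
      + 2 * n * F2 * spread_offset + n * residual_price\<^sup>2 * (2 / (1 - \<kappa>))) * ?P)"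
    by (simp only: distrib_right add.assoc)
  also have "\<dots> = violation_const \<kappa> (\<Sum>i\<in>{1..n}. ms i) * ?P"
    by (simp only: violation_const_def root_dim_def mult.assoc)
  finally show ?thesis .
qed

end

end

lemma power_step_iteration:
  assumes \<kappa>: "0 < \<kappa>" "\<kappa> < 1" and "1 \<le> n" "0 < w" "0 < B"
    and "graph_assumption n E W w B"
    and "function_assumption p n ms X f g df dg r R F1 F2"
    and "generated_by_algorithm n ms X g df dg W
      (\<lambda>t. 1 / real t powr \<kappa>) (\<lambda>t. 1 / real t powr \<kappa>) (\<lambda>t. 1 / real t powr (1 - \<kappa>)) x q"
  shows "primal_dual_iteration n E W w B p ms X f g df dg r R F1 F2
      (\<lambda>t. 1 / real t powr \<kappa>) (\<lambda>t. 1 / real t powr \<kappa>) (\<lambda>t. 1 / real t powr (1 - \<kappa>)) x q"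
proof
  have antimono: "1 / real (t + 1) powr a \<le> 1 / real t powr a" if "1 \<le> t" "0 < a" for t a
    using that by (intro divide_left_mono powr_mono2) auto
  fix t :: nat
  assume t: "1 \<le> t"
  show "1 / real (t + 1) powr \<kappa> \<le> 1 / real t powr \<kappa>"
    and "1 / real (t + 1) powr (1 - \<kappa>) \<le> 1 / real t powr (1 - \<kappa>)"
    using antimono t \<kappa> by auto
  \<comment> \<open>The exponents add up to 1, so the product is 1 / t.\<close>
  show "1 / real t powr \<kappa> * (1 / real t powr (1 - \<kappa>)) \<le> 1"
    using t by (simp flip: powr_add)
  show "1 / (1 / real (t + 1) powr (1 - \<kappa>)) - 1 / (1 / real t powr (1 - \<kappa>)) \<le> 1 / real (t + 1) powr \<kappa>"
    using powr_increment_le[OF t \<kappa>] by simp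
qed (use assms in auto)

theorem corollary1:
  fixes \<kappa> F1 F2 R w :: real and n m B :: nat
  assumes "0 < \<kappa>" and "\<kappa> < 1"
    and "1 \<le> n" and "0 < w" and "w < 1" and "0 < B"
  shows "\<exists>C1>0. \<exists>C2>0. \<forall>p ms X f g df dg r E W x q.
    (\<Sum>i\<in>{1..n}. ms i) = m \<longrightarrow>
    function_assumption p n ms X f g df dg r R F1 F2 \<longrightarrow>
    (\<forall>T\<ge>1. static_feasible n ms X g T \<noteq> {}) \<longrightarrow>
    graph_assumption n E W w B \<longrightarrow>
    generated_by_algorithm n ms X g df dg W
      (\<lambda>t. 1 / real t powr \<kappa>) (\<lambda>t. 1 / real t powr \<kappa>) (\<lambda>t. 1 / real t powr (1 - \<kappa>)) x q \<longrightarrow>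
    (\<forall>T\<ge>1.
      (\<forall>xstar.
        is_arg_min (\<lambda>y. \<Sum>t\<in>{1..T}. global_loss n f t y) (\<lambda>y. y \<in> static_feasible n ms X g T) xstar \<longrightarrow>
        net_reg n f x (\<lambda>_. xstar) T \<le> C1 * real T powr max \<kappa> (1 - \<kappa>)) \<and>
      (1 / real n) * (\<Sum>i\<in>{1..n}. \<Sum>t\<in>{1..T}. norm (pos_part (global_constr n ms g t (x i t))))
        \<le> C2 * real T powr (1 - \<kappa> / 2))"
proof -
  \<comment> \<open>Absolute values because the formulas are nonnegative only if some problem data exists for
    the given \<open>F1\<close>, \<open>F2\<close> and \<open>R\<close>.\<close>
  define C1 where "C1 = \<bar>primal_dual_iteration.regret_const n w B R F1 F2 \<kappa> / n\<bar> + 1"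
  define C2 where "C2 = \<bar>primal_dual_iteration.violation_const n w B R F1 F2 \<kappa> m / n\<bar> + 1"
  show ?thesis
  proof (rule exI[of _ C1], rule conjI[rotated], rule exI[of _ C2], intro conjI allI impI)
    show "0 < C1" "0 < C2"
      by (simp_all add: C1_def C2_def add_nonneg_pos)
    fix p ms X f g df dg r E W x q and T :: nat
    assume m: "(\<Sum>i\<in>{1..n}. ms i) = m"
      and "function_assumption p n ms X f g df dg r R F1 F2"
      and feasible: "\<forall>T\<ge>1. static_feasible n ms X g T \<noteq> {}"
      and "graph_assumption n E W w B"
      and "generated_by_algorithm n ms X g df dg W
        (\<lambda>t. 1 / real t powr \<kappa>) (\<lambda>t. 1 / real t powr \<kappa>) (\<lambda>t. 1 / real t powr (1 - \<kappa>)) x q"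
      and T: "1 \<le> T"
    then interpret primal_dual_iteration n E W w B p ms X f g df dg r R F1 F2
      "\<lambda>t. 1 / real t powr \<kappa>" "\<lambda>t. 1 / real t powr \<kappa>" "\<lambda>t. 1 / real t powr (1 - \<kappa>)" x q
      using assms by (intro power_step_iteration)
    {
      fix xstar
      assume "is_arg_min (\<lambda>y. \<Sum>t\<in>{1..T}. global_loss n f t y) (\<lambda>y. y \<in> static_feasible n ms X g T) xstar"
      then have "net_reg n f x (\<lambda>_. xstar) T \<le> regret_const \<kappa> / n * real T powr max \<kappa> (1 - \<kappa>)"
        by (intro net_reg_rate assms T refl) (simp add: is_arg_min_def)
      also have "\<dots> \<le> C1 * real T powr max \<kappa> (1 - \<kappa>)"
        unfolding C1_def by (intro mult_right_mono add_increasing2 abs_ge_self) auto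
      finally show "net_reg n f x (\<lambda>_. xstar) T \<le> C1 * real T powr max \<kappa> (1 - \<kappa>)" .
    }
    have "(1 / real n) * (\<Sum>i\<in>{1..n}. \<Sum>t\<in>{1..T}. norm (pos_part (global_constr n ms g t (x i t))))
        \<le> (1 / real n) * (violation_const \<kappa> m * real T powr (1 - \<kappa> / 2))"
      using violation_rate[OF assms(1,2) refl refl refl T] feasible T m by (intro mult_left_mono) auto
    also have "\<dots> = violation_const \<kappa> m / n * real T powr (1 - \<kappa> / 2)"
      by simp
    also have "\<dots> \<le> C2 * real T powr (1 - \<kappa> / 2)"
      unfolding C2_def by (intro mult_right_mono add_increasing2 abs_ge_self) auto
    finally show "(1 / real n) * (\<Sum>i\<in>{1..n}. \<Sum>t\<in>{1..T}. norm (pos_part (global_constr n ms g t (x i t))))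
        \<le> C2 * real T powr (1 - \<kappa> / 2)" .
  qed
qed

end
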